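(* Let $Z$ be a (positive-definite) conic Zermelo metric on $M$ with navigation data $(F,W)$ and let $\nu$ be a volume form on $M$. If $f$ is a smooth real function on some open set $\mathcal U\subset M$, then at regular $Z$-admissible points $$\frac{1}{Z(\nabla^Z f)}\left[\triangle^Z f-\operatorname{Hess}^Z f\left(\frac{\nabla^Z f}{Z(\nabla^Z f)},\frac{\nabla^Z f}{Z(\nabla^Z f)}\right)\right]=\frac{1}{F(\nabla^F f)}\left[\triangle^F f-\operatorname{Hess}^F f\left(\frac{\nabla^F f}{F(\nabla^F f)},\frac{\nabla^F f}{F(\nabla^F f)}\right)\right]+\operatorname{div}W .$$ In particular, if $f$ is a $Z$-distance function, then $$\triangle^Z f=\frac{1}{F(\nabla^F f)}\left(\triangle^F f-\operatorname{Hess}^F f\left(\frac{\nabla^F f}{F(\nabla^F f)},\frac{\nabla^F f}{F(\nabla^F f)}\right)\right)+\operatorname{div}W;$$ if, additionally, $W$ is tangent to the fibers of $f$, then $$\triangle^Z f=\triangle^F f+\operatorname{div}W .$$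
   Context: $M$ is a smooth connected $n$-dimensional manifold, $\pi:TM\to M$ its tangent bundle. A conic Finsler metric on $M$ is a continuous function $F:A\to[0,\infty)$, where $A\subset TM$ is open, conic ($rv\in A$ for $v\in A$, $r>0$), $\pi(A)=M$, each $A_p=A\cap T_pM$ is connected, $F$ is smooth on $A\setminus 0$, $F(rv)=rF(v)$ for $r>0$, and for each $v\in A\setminus 0$ the fundamental tensor $g_v(u_1,u_2)=\frac12\frac{\partial^2}{\partial t_2\partial t_1}F^2(v+t_1u_1+t_2u_2)|_{t_1=t_2=0}$ is positive-definite on $T_{\pi(v)}M$. It is a (regular) Finsler metric if $A=TM$. The Cartan tensor is $C_v(u_1,u_2,u_3)=\frac14\frac{\partial^3}{\partial t_3\partial t_2\partial t_1}F^2(v+\sum t_iu_i)|_{t_i=0}$. Conic Zermelo metric. Let $F:TM\to[0,\infty)$ be a Finsler metric with indicatrix $\Sigma^F=F^{-1}(1)$ and fundamental tensor $g^F$, and $W$ a smooth vector field on $M$. Let $\Sigma=\{u+W: u\in\Sigma^F,\ g^F_u(u,-W)<1\}$, $A\setminus0=\{rv: v\in\Sigma, r>0\}$, and define $Z:A\to[0,\infty)$ by $Z(v)=r>0$ iff $r^{-1}v\in\Sigma$, $Z(v)=0$ iff $v=0$. Then $F(v/Z(v)-W)=1$ for $v\in A\setminus0$, and $Z$ is a conic Finsler metric, called the conic Zermelo metric with navigation data $(F,W)$. For a conic Finsler metric (written $F$, with domain $A$): a vector field $V$ is admissible if $V(p)\in A_p\setminus0$ for all $p$. The Chern connection is the family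 of affine connections $\nabla^V$ ($V$ admissible) that are torsion-free and satisfy $Xg_V(Y,Z')=g_V(\nabla^V_XY,Z')+g_V(Y,\nabla^V_XZ')+2C_V(\nabla^V_XV,Y,Z')$ for smooth vector fields $X,Y,Z'$. The gradient $\nabla f$ of a smooth $f$ is defined where $df_p\neq0$ by $\nabla f_p\in A_p\setminus0$, $g_{\nabla f_p}(\nabla f_p,u)=df_p(u)$ for all $u\in T_pM$, when such a vector exists; regular admissible points are the points with $df_p\ne0$ at which such a gradient exists (for $Z$). The function is admissible if the gradient is defined as an admissible vector field on all of $\{df\ne0\}$ (and one sets $\nabla f=0$ where $df=0$). The Hessian is $\operatorname{Hess}f(u,v)=g_{\nabla f}(\nabla^{\nabla f}_u\nabla f,v)$ and the nonlinear Laplacian is $\triangle f=\operatorname{div}(\nabla f)$, where $(\operatorname{div}X)\nu=\mathcal L_X\nu$. A volume form $\nu$ is a smooth nowhere-vanishing family of local top-degree forms transforming with the absolute value of the Jacobian (a positive smooth density). A locally Lipschitz function $\rho:\mathcal U\to[0,\infty)$ is a distance function if it is admissible almost everywhere and $F(\nabla\rho)=1$ at all regular admissible points. Superscripts $Z$, $F$ indicate the metric used; all divergences are with respect to $\nu$. All displayed identities are at regular $Z$-admissible points of $f$. *)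

theory Defs
  imports "HOL-Analysis.Analysis"
begin

section \<open>Smooth maps between open subsets of normed spaces\<close>

primrec Ck_on :: "nat \<Rightarrow> ('a::real_normed_vector \<Rightarrow> 'b::real_normed_vector) \<Rightarrow> 'a set \<Rightarrow> bool" where
  "Ck_on 0 f S \<longleftrightarrow> continuous_on S f"
| "Ck_on (Suc k) f S \<longleftrightarrow> (\<forall>x\<in>S. f differentiable (at x)) \<and>
     (\<forall>v. Ck_on k (\<lambda>x. frechet_derivative f (at x) v) S)"

text \<open>Only meant for open \<open>S\<close>.\<close>

definition smooth_on :: "('a::real_normed_vector \<Rightarrow> 'b::real_normed_vector) \<Rightarrow> 'a set \<Rightarrow> bool" where
  "smooth_on f S \<longleftrightarrow> (\<forall>k. Ck_on k f S)"


section \<open>Smooth manifolds and their tangent bundle\<close>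

text \<open>
  A manifold is a topological type \<open>'m\<close> together with a smooth atlas of charts into
  \<open>real^'n\<close>, so its dimension is \<open>CARD('n)\<close>. A chart is a pair of its domain and its map;
  the values of the map outside the domain are irrelevant.
\<close>

type_synonym ('m, 'n) chart = "'m set \<times> ('m \<Rightarrow> real^'n)"

definition cinv :: "('m, 'n::finite) chart \<Rightarrow> real^'n \<Rightarrow> 'm" where
  "cinv c = inv_into (fst c) (snd c)"

definition smooth_atlas ::
  "('m::{t2_space, second_countable_topology}, 'n::finite) chart set \<Rightarrow> bool" where
  "smooth_atlas Atl \<longleftrightarrow>
     (\<forall>c\<in>Atl. open (fst c) \<and> open (snd c ` fst c) \<and>
        homeomorphism (fst c) (snd c ` fst c) (snd c) (cinv c)) \<and>
     (\<Union>c\<in>Atl. fst c) = UNIV \<and>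
     (\<forall>c\<in>Atl. \<forall>c'\<in>Atl. smooth_on (snd c' \<circ> cinv c) (snd c ` (fst c \<inter> fst c')))"

text \<open>
  For every point a chart around it is chosen once and for all. The tangent space at \<open>p\<close>
  is modelled by \<open>real^'n\<close>: a vector \<open>v\<close> stands for the tangent vector whose components in the
  chosen chart at \<open>p\<close> are \<open>v\<close>. Its components in another chart \<open>c\<close> are
  \<open>dchart Atl c p v\<close>. So \<open>TM\<close> is, as a set, the product of \<open>'m\<close> and \<open>real^'n\<close>, but its topology and
  smooth structure are the ones given by the bundle charts \<open>tchart Atl c\<close> below, and not
  the product ones (the chosen chart jumps from point to point).
\<close>

definition chart_at :: "('m, 'n::finite) chart set \<Rightarrow> 'm \<Rightarrow> ('m, 'n) chart" where
  "chart_at Atl p = (SOME c. c \<in> Atl \<and> p \<in> fst c)"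

definition dchart ::
  "('m, 'n::finite) chart set \<Rightarrow> ('m, 'n) chart \<Rightarrow> 'm \<Rightarrow> real^'n \<Rightarrow> real^'n" where
  "dchart Atl c p =
     frechet_derivative (snd c \<circ> cinv (chart_at Atl p)) (at (snd (chart_at Atl p) p))"

definition tchart ::
  "('m, 'n::finite) chart set \<Rightarrow> ('m, 'n) chart \<Rightarrow> 'm \<times> (real^'n) \<Rightarrow> (real^'n) \<times> (real^'n)" where
  "tchart Atl c = (\<lambda>(p, v). (snd c p, dchart Atl c p v))"

definition tchart_inv ::
  "('m, 'n::finite) chart set \<Rightarrow> ('m, 'n) chart \<Rightarrow> (real^'n) \<times> (real^'n) \<Rightarrow> 'm \<times> (real^'n)" where
  "tchart_inv Atl c = inv_into (fst c \<times> UNIV) (tchart Atl c)"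

definition open_TM :: "('m, 'n::finite) chart set \<Rightarrow> ('m \<times> (real^'n)) set \<Rightarrow> bool" where
  "open_TM Atl B \<longleftrightarrow> (\<forall>c\<in>Atl. open (tchart Atl c ` (B \<inter> fst c \<times> UNIV)))"

definition continuous_TM_on ::
  "('m, 'n::finite) chart set \<Rightarrow> ('m \<times> (real^'n)) set \<Rightarrow> ('m \<Rightarrow> real^'n \<Rightarrow> real) \<Rightarrow> bool" where
  "continuous_TM_on Atl B F \<longleftrightarrow> (\<forall>c\<in>Atl.
     continuous_on (tchart Atl c ` (B \<inter> fst c \<times> UNIV)) (case_prod F \<circ> tchart_inv Atl c))"

definition smooth_TM_on ::
  "('m, 'n::finite) chart set \<Rightarrow> ('m \<times> (real^'n)) set \<Rightarrow> ('m \<Rightarrow> real^'n \<Rightarrow> real) \<Rightarrow> bool" where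
  "smooth_TM_on Atl B F \<longleftrightarrow> (\<forall>c\<in>Atl.
     smooth_on (case_prod F \<circ> tchart_inv Atl c) (tchart Atl c ` (B \<inter> fst c \<times> UNIV)))"


subsection \<open>Functions and vector fields\<close>

definition smooth_fun_on :: "('m, 'n::finite) chart set \<Rightarrow> 'm set \<Rightarrow> ('m \<Rightarrow> real) \<Rightarrow> bool" where
  "smooth_fun_on Atl U f \<longleftrightarrow> (\<forall>c\<in>Atl. smooth_on (f \<circ> cinv c) (snd c ` (U \<inter> fst c)))"

definition differentiable_at :: "('m, 'n::finite) chart set \<Rightarrow> ('m \<Rightarrow> real) \<Rightarrow> 'm \<Rightarrow> bool" where
  "differentiable_at Atl f p \<longleftrightarrow>
     (f \<circ> cinv (chart_at Atl p)) differentiable (at (snd (chart_at Atl p) p))"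

definition differential ::
  "('m, 'n::finite) chart set \<Rightarrow> ('m \<Rightarrow> real) \<Rightarrow> 'm \<Rightarrow> real^'n \<Rightarrow> real" where
  "differential Atl f p =
     frechet_derivative (f \<circ> cinv (chart_at Atl p)) (at (snd (chart_at Atl p) p))"

definition vf_rep ::
  "('m, 'n::finite) chart set \<Rightarrow> ('m, 'n) chart \<Rightarrow> ('m \<Rightarrow> real^'n) \<Rightarrow> real^'n \<Rightarrow> real^'n" where
  "vf_rep Atl c X x = dchart Atl c (cinv c x) (X (cinv c x))"

definition smooth_vf_on ::
  "('m, 'n::finite) chart set \<Rightarrow> 'm set \<Rightarrow> ('m \<Rightarrow> real^'n) \<Rightarrow> bool" where
  "smooth_vf_on Atl U X \<longleftrightarrow> (\<forall>c\<in>Atl. smooth_on (vf_rep Atl c X) (snd c ` (U \<inter> fst c)))"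

definition bracket :: "(real^'n \<Rightarrow> real^'n) \<Rightarrow> (real^'n \<Rightarrow> real^'n) \<Rightarrow> real^'n \<Rightarrow> real^'n::finite" where
  "bracket X Y x = frechet_derivative Y (at x) (X x) - frechet_derivative X (at x) (Y x)"

definition lie_bracket ::
  "('m, 'n::finite) chart set \<Rightarrow> ('m \<Rightarrow> real^'n) \<Rightarrow> ('m \<Rightarrow> real^'n) \<Rightarrow> 'm \<Rightarrow> real^'n" where
  "lie_bracket Atl X Y p = (let c = chart_at Atl p in
     bracket (vf_rep Atl c X) (vf_rep Atl c Y) (snd c p))"


subsection \<open>Volume forms and divergence\<close>

text \<open>
  \<open>\<nu> c p\<close> is the coefficient at \<open>p\<close> of the local top-degree form
  \<open>\<nu> c dx\<^sub>1 \<and> \<dots> \<and> dx\<^sub>n\<close> in the coordinates of the chart \<open>c\<close>.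
\<close>

definition volume_form ::
  "('m, 'n::finite) chart set \<Rightarrow> (('m, 'n) chart \<Rightarrow> 'm \<Rightarrow> real) \<Rightarrow> bool" where
  "volume_form Atl \<nu> \<longleftrightarrow>
     (\<forall>c\<in>Atl. smooth_on (\<nu> c \<circ> cinv c) (snd c ` fst c) \<and> (\<forall>p\<in>fst c. \<nu> c p > 0)) \<and>
     (\<forall>c\<in>Atl. \<forall>c'\<in>Atl. \<forall>p\<in>fst c \<inter> fst c'.
        \<nu> c p = \<bar>det (matrix (frechet_derivative (snd c' \<circ> cinv c) (at (snd c p))))\<bar> * \<nu> c' p)"

text \<open>The arguments of a top-degree form on \<open>real^'n\<close> are collected as the rows of a matrix.\<close>

definition local_top_form ::
  "(('m, 'n::finite) chart \<Rightarrow> 'm \<Rightarrow> real) \<Rightarrow> ('m, 'n) chart \<Rightarrow> real^'n \<Rightarrow> real^'n^'n \<Rightarrow> real" where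
  "local_top_form \<nu> c x Y = \<nu> c (cinv c x) * det Y"

text \<open>
  The Lie derivative of a top-degree form, evaluated on vector fields \<open>Y\<^sub>1, \<dots>, Y\<^sub>n\<close>:
  \[ (L_X \omega)(Y_1,\dots,Y_n) = X(\omega(Y_1,\dots,Y_n))
       - \sum_i \omega(Y_1,\dots,[X,Y_i],\dots,Y_n). \]
\<close>

definition lie_derivative_top ::
  "(real^'n::finite \<Rightarrow> real^'n) \<Rightarrow> (real^'n \<Rightarrow> real^'n^'n \<Rightarrow> real) \<Rightarrow>
   ('n \<Rightarrow> real^'n \<Rightarrow> real^'n) \<Rightarrow> real^'n \<Rightarrow> real" where
  "lie_derivative_top X \<omega> Y x =
     frechet_derivative (\<lambda>y. \<omega> y (\<chi> j. Y j y)) (at x) (X x)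
     - (\<Sum>i\<in>UNIV. \<omega> x (\<chi> j. if j = i then bracket X (Y i) x else Y j x))"

text \<open>
  The factor \<open>div X\<close> in \<open>(div X) \<nu> = L\<^sub>X \<nu>\<close>; as both sides are top-degree forms, it is
  determined by evaluating them on a single frame, here the coordinate frame of the chosen chart.
\<close>

definition divergence ::
  "('m, 'n::finite) chart set \<Rightarrow> (('m, 'n) chart \<Rightarrow> 'm \<Rightarrow> real) \<Rightarrow> ('m \<Rightarrow> real^'n) \<Rightarrow> 'm \<Rightarrow> real" where
  "divergence Atl \<nu> X p = (let c = chart_at Atl p in
     lie_derivative_top (vf_rep Atl c X) (local_top_form \<nu> c) (\<lambda>i y. axis i 1) (snd c p)
     / local_top_form \<nu> c (snd c p) (\<chi> i. axis i 1))"


section \<open>Conic Finsler metrics\<close>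

definition fund_tensor ::
  "('m \<Rightarrow> real^'n \<Rightarrow> real) \<Rightarrow> 'm \<Rightarrow> real^'n \<Rightarrow> real^'n \<Rightarrow> real^'n::finite \<Rightarrow> real" where
  "fund_tensor F p v u1 u2 =
     1/2 * deriv (\<lambda>t2. deriv (\<lambda>t1. (F p (v + t1 *\<^sub>R u1 + t2 *\<^sub>R u2))\<^sup>2) 0) 0"

definition cartan_tensor ::
  "('m \<Rightarrow> real^'n \<Rightarrow> real) \<Rightarrow> 'm \<Rightarrow> real^'n \<Rightarrow> real^'n \<Rightarrow> real^'n \<Rightarrow> real^'n::finite \<Rightarrow> real" where
  "cartan_tensor F p v u1 u2 u3 =
     1/4 * deriv (\<lambda>t3. deriv (\<lambda>t2. deriv (\<lambda>t1.
       (F p (v + t1 *\<^sub>R u1 + t2 *\<^sub>R u2 + t3 *\<^sub>R u3))\<^sup>2) 0) 0) 0"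

text \<open>The values of \<open>F\<close> outside of its domain \<open>A\<close> are irrelevant.\<close>

definition conic_finsler_metric ::
  "('m, 'n::finite) chart set \<Rightarrow> ('m \<times> (real^'n)) set \<Rightarrow> ('m \<Rightarrow> real^'n \<Rightarrow> real) \<Rightarrow> bool" where
  "conic_finsler_metric Atl A F \<longleftrightarrow>
     open_TM Atl A \<and>
     (\<forall>p v r. (p, v) \<in> A \<longrightarrow> r > 0 \<longrightarrow> (p, r *\<^sub>R v) \<in> A) \<and>
     fst ` A = UNIV \<and>
     (\<forall>p. connected {v. (p, v) \<in> A}) \<and>
     (\<forall>p v. (p, v) \<in> A \<longrightarrow> F p v \<ge> 0) \<and>
     continuous_TM_on Atl A F \<and>
     smooth_TM_on Atl {(p, v) \<in> A. v \<noteq> 0} F \<and>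
     (\<forall>p v r. (p, v) \<in> A \<longrightarrow> r > 0 \<longrightarrow> F p (r *\<^sub>R v) = r * F p v) \<and>
     (\<forall>p v. (p, v) \<in> A \<longrightarrow> v \<noteq> 0 \<longrightarrow> (\<forall>u. u \<noteq> 0 \<longrightarrow> fund_tensor F p v u u > 0))"

definition finsler_metric :: "('m, 'n::finite) chart set \<Rightarrow> ('m \<Rightarrow> real^'n \<Rightarrow> real) \<Rightarrow> bool" where
  "finsler_metric Atl F \<longleftrightarrow> conic_finsler_metric Atl UNIV F"

subsection \<open>Conic Zermelo metrics\<close>

definition zermelo_indicatrix ::
  "('m \<Rightarrow> real^'n \<Rightarrow> real) \<Rightarrow> ('m \<Rightarrow> real^'n) \<Rightarrow> ('m \<times> (real^'n::finite)) set" where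
  "zermelo_indicatrix F W = {(p, u + W p) | p u. F p u = 1 \<and> fund_tensor F p u u (- W p) < 1}"

text \<open>
  The navigation data determine \<open>A\<close> off the zero section only. Which zero vectors may belong to \<open>A\<close>
  is left to the requirement that \<open>Z\<close> be a conic Finsler metric on \<open>A\<close>.
\<close>

definition conic_zermelo_metric ::
  "('m, 'n::finite) chart set \<Rightarrow> ('m \<Rightarrow> real^'n \<Rightarrow> real) \<Rightarrow> ('m \<Rightarrow> real^'n) \<Rightarrow>
   ('m \<times> (real^'n)) set \<Rightarrow> ('m \<Rightarrow> real^'n \<Rightarrow> real) \<Rightarrow> bool" where
  "conic_zermelo_metric Atl F W A Z \<longleftrightarrow>
     finsler_metric Atl F \<and> smooth_vf_on Atl UNIV W \<and>
     conic_finsler_metric Atl A Z \<and>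
     {(p, v) \<in> A. v \<noteq> 0} = {(p, r *\<^sub>R v) | p r v. (p, v) \<in> zermelo_indicatrix F W \<and> r > 0} \<and>
     (\<forall>p v r. (p, v) \<in> A \<longrightarrow> r > 0 \<longrightarrow>
        (Z p v = r \<longleftrightarrow> (p, v /\<^sub>R r) \<in> zermelo_indicatrix F W)) \<and>
     (\<forall>p v. (p, v) \<in> A \<longrightarrow> (Z p v = 0 \<longleftrightarrow> v = 0))"


subsection \<open>Chern connection\<close>

definition admissible_on :: "('m \<times> (real^'n)) set \<Rightarrow> 'm set \<Rightarrow> ('m \<Rightarrow> real^'n::finite) \<Rightarrow> bool" where
  "admissible_on A U V \<longleftrightarrow> (\<forall>p\<in>U. (p, V p) \<in> A \<and> V p \<noteq> 0)"

text \<open>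
  \<open>D p u Y\<close> is the covariant derivative at \<open>p\<close> of the vector field \<open>Y\<close> in the direction of the
  tangent vector \<open>u\<close>, so the vector field \<open>\<nabla>\<^sub>X Y\<close> is \<open>\<lambda>p. D p (X p) Y\<close>.
\<close>

type_synonym ('m, 'n) connection = "'m \<Rightarrow> real^'n \<Rightarrow> ('m \<Rightarrow> real^'n) \<Rightarrow> real^'n"

definition affine_connection_on ::
  "('m, 'n::finite) chart set \<Rightarrow> 'm set \<Rightarrow> ('m, 'n) connection \<Rightarrow> bool" where
  "affine_connection_on Atl U D \<longleftrightarrow>
     (\<forall>X Y. smooth_vf_on Atl U X \<longrightarrow> smooth_vf_on Atl U Y \<longrightarrow>
        smooth_vf_on Atl U (\<lambda>p. D p (X p) Y)) \<and>
     (\<forall>Y. smooth_vf_on Atl U Y \<longrightarrow> (\<forall>p\<in>U. linear (\<lambda>u. D p u Y))) \<and>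
     (\<forall>Y1 Y2. smooth_vf_on Atl U Y1 \<longrightarrow> smooth_vf_on Atl U Y2 \<longrightarrow>
        (\<forall>p\<in>U. \<forall>u. D p u (\<lambda>q. Y1 q + Y2 q) = D p u Y1 + D p u Y2)) \<and>
     (\<forall>h Y. smooth_fun_on Atl U h \<longrightarrow> smooth_vf_on Atl U Y \<longrightarrow>
        (\<forall>p\<in>U. \<forall>u. D p u (\<lambda>q. h q *\<^sub>R Y q) = differential Atl h p u *\<^sub>R Y p + h p *\<^sub>R D p u Y))"

definition torsion_free_on ::
  "('m, 'n::finite) chart set \<Rightarrow> 'm set \<Rightarrow> ('m, 'n) connection \<Rightarrow> bool" where
  "torsion_free_on Atl U D \<longleftrightarrow>
     (\<forall>X Y. smooth_vf_on Atl U X \<longrightarrow> smooth_vf_on Atl U Y \<longrightarrow>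
        (\<forall>p\<in>U. D p (X p) Y - D p (Y p) X = lie_bracket Atl X Y p))"

definition almost_metric_on ::
  "('m, 'n::finite) chart set \<Rightarrow> ('m \<Rightarrow> real^'n \<Rightarrow> real) \<Rightarrow> 'm set \<Rightarrow> ('m \<Rightarrow> real^'n) \<Rightarrow>
   ('m, 'n) connection \<Rightarrow> bool" where
  "almost_metric_on Atl F U V D \<longleftrightarrow>
     (\<forall>X Y Y'. smooth_vf_on Atl U X \<longrightarrow> smooth_vf_on Atl U Y \<longrightarrow> smooth_vf_on Atl U Y' \<longrightarrow>
        (\<forall>p\<in>U. differential Atl (\<lambda>q. fund_tensor F q (V q) (Y q) (Y' q)) p (X p) =
           fund_tensor F p (V p) (D p (X p) Y) (Y' p) + fund_tensor F p (V p) (Y p) (D p (X p) Y')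
           + 2 * cartan_tensor F p (V p) (D p (X p) V) (Y p) (Y' p)))"

text \<open>
  The Chern connection as a family of affine connections \<open>D U V\<close>, one for every admissible
  vector field \<open>V\<close> on an open set \<open>U\<close>. These conditions determine \<open>D U V\<close> on smooth vector fields
  on \<open>U\<close> uniquely.
\<close>

definition chern_connection ::
  "('m::topological_space, 'n::finite) chart set \<Rightarrow> ('m \<times> (real^'n)) set \<Rightarrow>
   ('m \<Rightarrow> real^'n \<Rightarrow> real) \<Rightarrow> ('m set \<Rightarrow> ('m \<Rightarrow> real^'n) \<Rightarrow> ('m, 'n) connection) \<Rightarrow> bool" where
  "chern_connection Atl A F D \<longleftrightarrow>
     (\<forall>U V. open U \<longrightarrow> smooth_vf_on Atl U V \<longrightarrow> admissible_on A U V \<longrightarrow>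
        affine_connection_on Atl U (D U V) \<and> torsion_free_on Atl U (D U V) \<and>
        almost_metric_on Atl F U V (D U V))"


subsection \<open>Gradient, Hessian and Laplacian\<close>

definition is_gradient ::
  "('m, 'n::finite) chart set \<Rightarrow> ('m \<times> (real^'n)) set \<Rightarrow> ('m \<Rightarrow> real^'n \<Rightarrow> real) \<Rightarrow>
   ('m \<Rightarrow> real) \<Rightarrow> 'm \<Rightarrow> real^'n \<Rightarrow> bool" where
  "is_gradient Atl A F f p v \<longleftrightarrow>
     (p, v) \<in> A \<and> v \<noteq> 0 \<and> (\<forall>u. fund_tensor F p v v u = differential Atl f p u)"

definition gradient ::
  "('m, 'n::finite) chart set \<Rightarrow> ('m \<times> (real^'n)) set \<Rightarrow> ('m \<Rightarrow> real^'n \<Rightarrow> real) \<Rightarrow>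
   ('m \<Rightarrow> real) \<Rightarrow> 'm \<Rightarrow> real^'n" where
  "gradient Atl A F f p =
     (if differential Atl f p = (\<lambda>u. 0) then 0 else (THE v. is_gradient Atl A F f p v))"

definition regular_admissible ::
  "('m, 'n::finite) chart set \<Rightarrow> ('m \<times> (real^'n)) set \<Rightarrow> ('m \<Rightarrow> real^'n \<Rightarrow> real) \<Rightarrow>
   'm set \<Rightarrow> ('m \<Rightarrow> real) \<Rightarrow> 'm set" where
  "regular_admissible Atl A F U f = {p \<in> U. differentiable_at Atl f p \<and>
     differential Atl f p \<noteq> (\<lambda>u. 0) \<and> (\<exists>v. is_gradient Atl A F f p v)}"

text \<open>
  The reference vector field of the Hessian is the gradient of \<open>f\<close> on the set of
  regular admissible points of \<open>f\<close> in \<open>U\<close>.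
\<close>

definition hessian ::
  "('m, 'n::finite) chart set \<Rightarrow> ('m \<times> (real^'n)) set \<Rightarrow> ('m \<Rightarrow> real^'n \<Rightarrow> real) \<Rightarrow>
   ('m set \<Rightarrow> ('m \<Rightarrow> real^'n) \<Rightarrow> ('m, 'n) connection) \<Rightarrow>
   'm set \<Rightarrow> ('m \<Rightarrow> real) \<Rightarrow> 'm \<Rightarrow> real^'n \<Rightarrow> real^'n \<Rightarrow> real" where
  "hessian Atl A F D U f p u v =
     (let G = gradient Atl A F f in
      fund_tensor F p (G p) (D (regular_admissible Atl A F U f) G p u G) v)"

definition laplacian ::
  "('m, 'n::finite) chart set \<Rightarrow> ('m \<times> (real^'n)) set \<Rightarrow> ('m \<Rightarrow> real^'n \<Rightarrow> real) \<Rightarrow>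
   (('m, 'n) chart \<Rightarrow> 'm \<Rightarrow> real) \<Rightarrow> ('m \<Rightarrow> real) \<Rightarrow> 'm \<Rightarrow> real" where
  "laplacian Atl A F \<nu> f p = divergence Atl \<nu> (gradient Atl A F f) p"


subsection \<open>Distance functions\<close>

definition locally_lipschitz_on ::
  "('m, 'n::finite) chart set \<Rightarrow> 'm set \<Rightarrow> ('m \<Rightarrow> real) \<Rightarrow> bool" where
  "locally_lipschitz_on Atl U f \<longleftrightarrow> (\<forall>c\<in>Atl. \<forall>x\<in>snd c ` (U \<inter> fst c).
     \<exists>N L. open N \<and> x \<in> N \<and> N \<subseteq> snd c ` (U \<inter> fst c) \<and> L-lipschitz_on N (f \<circ> cinv c))"

text \<open>
  A function is admissible at \<open>p\<close> if its gradient is defined there, including the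
  convention that it is \<open>0\<close> at critical points.
\<close>

definition admissible_at ::
  "('m, 'n::finite) chart set \<Rightarrow> ('m \<times> (real^'n)) set \<Rightarrow> ('m \<Rightarrow> real^'n \<Rightarrow> real) \<Rightarrow>
   ('m \<Rightarrow> real) \<Rightarrow> 'm \<Rightarrow> bool" where
  "admissible_at Atl A F f p \<longleftrightarrow> differentiable_at Atl f p \<and>
     (differential Atl f p = (\<lambda>u. 0) \<or> (\<exists>v. is_gradient Atl A F f p v))"

definition distance_function ::
  "('m, 'n::finite) chart set \<Rightarrow> ('m \<times> (real^'n)) set \<Rightarrow> ('m \<Rightarrow> real^'n \<Rightarrow> real) \<Rightarrow>
   'm set \<Rightarrow> ('m \<Rightarrow> real) \<Rightarrow> bool" where
  "distance_function Atl A F U \<rho> \<longleftrightarrow>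
     (\<forall>p\<in>U. \<rho> p \<ge> 0) \<and> locally_lipschitz_on Atl U \<rho> \<and>
     (\<forall>c\<in>Atl. negligible (snd c ` {p \<in> U \<inter> fst c. \<not> admissible_at Atl A F \<rho> p})) \<and>
     (\<forall>p\<in>regular_admissible Atl A F U \<rho>. F p (gradient Atl A F \<rho> p) = 1)"

text \<open>
  A tangent vector is tangent to the fiber of \<open>f\<close> through \<open>p\<close> if it is the velocity of a curve in
  that fiber; only the regular points, near which the fiber is a hypersurface, are considered.
\<close>

definition tangent_to_fibers ::
  "('m, 'n::finite) chart set \<Rightarrow> 'm set \<Rightarrow> ('m \<Rightarrow> real) \<Rightarrow> ('m \<Rightarrow> real^'n) \<Rightarrow> bool" where
  "tangent_to_fibers Atl U f W \<longleftrightarrow>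
     (\<forall>p\<in>U. differential Atl f p \<noteq> (\<lambda>u. 0) \<longrightarrow>
        (\<exists>\<gamma>::real \<Rightarrow> 'm. \<gamma> 0 = p \<and>
           (\<forall>\<^sub>F t in nhds 0. \<gamma> t \<in> U \<inter> fst (chart_at Atl p) \<and> f (\<gamma> t) = f p) \<and>
           ((snd (chart_at Atl p) \<circ> \<gamma>) has_vector_derivative W p) (at 0)))"

end

theory Submission
  imports Defs
begin

text \<open>
  Write \<open>h = F(\<nabla>f)\<close> for the length of a gradient and \<open>n = \<nabla>f / h\<close> for the unit normal of the level sets of \<open>f\<close>.
  For every conic Finsler metric with a smooth gradient,
  \[ \frac{1}{h} \left( \triangle f - \mathrm{Hess} f (n, n) \right) = \mathrm{div}\, n . \]
  Indeed \<open>\<triangle>f = div (h n) = h div n + dh(n)\<close>, and the Hessian term is \<open>dh(n)\<close>: in the almost metric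
  condition of the Chern connection with all three fields and the reference field equal to \<open>\<nabla>f\<close>, the Cartan
  term vanishes by homogeneity, and what remains is \<open>d(h\<^sup>2)(\<nabla>f) = 2 h\<^sup>2 Hess f (n, n)\<close>
  (\<open>hessian_gradient\<close>, \<open>divergence_normalized_gradient\<close>).

  So only the two unit normals have to be compared. The indicatrix of \<open>Z\<close> is that of \<open>F\<close> translated
  by the wind. Differentiating \<open>F(v / Z(v) - W) = 1\<close> shows that corresponding points of the indicatrices
  have the same conormal directions, with the same orientation because of the condition
  \<open>g\<^sub>u(u, -W) < 1\<close> (\<open>fund_tensor_unwind\<close>). Hence a gradient for \<open>Z\<close> gives one for \<open>F\<close>, the unit
  normals satisfy \<open>n\<^sup>Z = n\<^sup>F + W\<close> (\<open>gradient_unwind\<close>), and the formula follows by taking divergences.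
  For a distance function \<open>Z(\<nabla>f) = 1\<close> on an open set, so the Hessian term for \<open>Z\<close> vanishes; if moreover
  \<open>df(W) = 0\<close>, applying \<open>df\<close> to \<open>n\<^sup>Z = n\<^sup>F + W\<close> gives \<open>F(\<nabla>f) = 1\<close> for the gradient of \<open>F\<close> as well.

  The analytic content is that the regular admissible points form an open set on which the gradient is a
  smooth field (\<open>open_regular\<close>, \<open>smooth_gradient\<close>); the Chern connection and the divergence presuppose it.
  In a bundle chart the gradient solves \<open>L(x, y) = df\<^sub>x\<close>, where the Legendre transformation \<open>L\<close> is the
  fiber derivative of \<open>F\<^sup>2 / 2\<close> and the fiber derivative of \<open>L\<close> is the positive definite fundamental
  tensor. If \<open>L\<close> is injective on fibers, then \<open>(x, y) \<mapsto> (x, L(x, y))\<close> has an open image by invariance of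
  domain and a differentiable inverse, and differentiating the implicit equation repeatedly gives smoothness.
  Injectivity holds for \<open>F\<close> by convexity of \<open>F\<^sup>2\<close> on whole fibers, and it passes to \<open>Z\<close> through the
  correspondence of conormals.
\<close>

section \<open>Calculus of maps of class \<open>C\<^sup>k\<close>\<close>

lemma Ck_on_cong:
  assumes "open S" "\<And>x. x \<in> S \<Longrightarrow> f x = g x" "Ck_on k f S"
  shows "Ck_on k g S"
  using assms(2,3)
proof (induction k arbitrary: f g)
  case 0
  then show ?case using continuous_on_cong[OF refl, of S f g] by simp
next
  case (Suc k)
  have d: "g differentiable (at x)"
    and e: "frechet_derivative f (at x) = frechet_derivative g (at x)" if "x \<in> S" for x
  proof -
    have f: "f differentiable (at x)" using Suc.prems that by simp
    then have "(f has_derivative frechet_derivative f (at x)) (at x)"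
      by (simp add: frechet_derivative_works)
    then have *: "(g has_derivative frechet_derivative f (at x)) (at x)"
      using has_derivative_transform_within_open[OF _ assms(1) that] Suc.prems(1) by blast
    then show "g differentiable (at x)" by (auto simp: differentiable_def)
    show "frechet_derivative f (at x) = frechet_derivative g (at x)"
      by (rule frechet_derivative_at[OF *])
  qed
  have "Ck_on k (\<lambda>x. frechet_derivative g (at x) v) S" for v
  proof (rule Suc.IH)
    show "frechet_derivative f (at x) v = frechet_derivative g (at x) v" if "x \<in> S" for x
      by (simp only: e[OF that])
    show "Ck_on k (\<lambda>x. frechet_derivative f (at x) v) S"
      using Suc.prems(2) by simp
  qed
  with d show ?case by simp
qed

lemma Ck_on_subset: "Ck_on k f S \<Longrightarrow> T \<subseteq> S \<Longrightarrow> Ck_on k f T"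
  by (induction k arbitrary: f) (auto intro: continuous_on_subset)

lemma Ck_on_frechet_derivative:
  "Ck_on (Suc k) f S \<Longrightarrow> Ck_on k (\<lambda>x. frechet_derivative f (at x) v) S"
  unfolding Ck_on.simps by (elim conjE) (erule spec)

lemma Ck_on_Suc_has_derivative:
  assumes "open S" "\<And>x. x \<in> S \<Longrightarrow> (f has_derivative f' x) (at x)"
    and "\<And>v. Ck_on k (\<lambda>x. f' x v) S"
  shows "Ck_on (Suc k) f S"
proof -
  have "Ck_on k (\<lambda>x. frechet_derivative f (at x) v) S" for v
    by (rule Ck_on_cong[OF assms(1) _ assms(3)[of v]])
       (rule fun_cong[OF frechet_derivative_at[OF assms(2)]])
  moreover have "\<forall>x\<in>S. f differentiable (at x)"
    using differentiableI[OF assms(2)] by (rule ballI)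
  ultimately show ?thesis unfolding Ck_on.simps by (intro conjI allI)
qed

lemma Ck_on_imp_continuous_on:
  assumes "Ck_on k f S" shows "continuous_on S f"
proof (cases k)
  case 0
  then show ?thesis using assms by simp
next
  case (Suc j)
  with assms have "f differentiable (at x)" if "x \<in> S" for x using that by simp
  then show ?thesis
    by (meson continuous_at_imp_continuous_on differentiable_imp_continuous_within)
qed

lemma Ck_on_Suc_imp: "Ck_on (Suc k) f S \<Longrightarrow> Ck_on k f S"
proof (induction k arbitrary: f)
  case 0
  then show ?case unfolding Ck_on.simps(1) by (rule Ck_on_imp_continuous_on)
next
  case (Suc k)
  have "Ck_on k (\<lambda>x. frechet_derivative f (at x) v) S" for v
    by (rule Suc.IH) (use Suc.prems in simp)
  moreover have "\<forall>x\<in>S. f differentiable (at x)" using Suc.prems by simp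
  ultimately show ?case by simp
qed

lemma Ck_on_has_derivative:
  "Ck_on (Suc k) f S \<Longrightarrow> x \<in> S \<Longrightarrow> (f has_derivative frechet_derivative f (at x)) (at x)"
  by (simp flip: frechet_derivative_works)

lemma Ck_on_const: "Ck_on k (\<lambda>x. c) S"
  by (induction k arbitrary: c) (auto simp: frechet_derivative_const)

lemma Ck_on_linear_comp:
  assumes "open S" "bounded_linear L" "Ck_on k f S"
  shows "Ck_on k (\<lambda>x. L (f x)) S"
  using assms(3)
proof (induction k arbitrary: f)
  case 0
  then show ?case
    using bounded_linear.continuous_on[OF assms(2)] by simp
next
  case (Suc k)
  show ?case
  proof (rule Ck_on_Suc_has_derivative[OF assms(1)])
    fix x assume "x \<in> S"
    from bounded_linear.has_derivative[OF assms(2) Ck_on_has_derivative[OF Suc.prems this]]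
    show "((\<lambda>x. L (f x)) has_derivative (\<lambda>v. L (frechet_derivative f (at x) v))) (at x)" .
  qed (rule Suc.IH; use Suc.prems in simp)
qed

lemma Ck_on_linear:
  assumes "open S" "bounded_linear L" shows "Ck_on k L S"
proof (cases k)
  case 0
  then show ?thesis using linear_continuous_on[OF assms(2)] by simp
next
  case (Suc j)
  show ?thesis unfolding Suc
    by (rule Ck_on_Suc_has_derivative[OF assms(1) bounded_linear_imp_has_derivative[OF assms(2)]])
       (rule Ck_on_const)
qed

lemma Ck_on_add:
  assumes "open S" "Ck_on k f S" "Ck_on k g S"
  shows "Ck_on k (\<lambda>x. f x + g x) S"
  using assms(2,3)
proof (induction k arbitrary: f g)
  case 0
  then show ?case by (simp add: continuous_on_add)
next
  case (Suc k)
  show ?case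
  proof (rule Ck_on_Suc_has_derivative[OF assms(1)])
    fix x assume "x \<in> S"
    from has_derivative_add[OF Suc.prems[THEN Ck_on_has_derivative, OF this]]
    show "((\<lambda>x. f x + g x) has_derivative
       (\<lambda>v. frechet_derivative f (at x) v + frechet_derivative g (at x) v)) (at x)" .
  qed (rule Suc.IH; use Suc.prems in simp)
qed

lemma Ck_on_sum:
  assumes "open S" "\<And>i. i \<in> I \<Longrightarrow> Ck_on k (f i) S"
  shows "Ck_on k (\<lambda>x. \<Sum>i\<in>I. f i x) S"
  using assms(2)
  by (induction I rule: infinite_finite_induct) (auto intro!: Ck_on_const Ck_on_add[OF assms(1)])

lemma Ck_on_bilinear:
  assumes "open S" "bounded_bilinear B" "Ck_on k f S" "Ck_on k g S"
  shows "Ck_on k (\<lambda>x. B (f x) (g x)) S"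
  using assms(3,4)
proof (induction k arbitrary: f g)
  case 0
  then show ?case using bounded_bilinear.continuous_on[OF assms(2)] by simp
next
  case (Suc k)
  show ?case
  proof (rule Ck_on_Suc_has_derivative[OF assms(1)])
    fix x assume "x \<in> S"
    from bounded_bilinear.FDERIV[OF assms(2) Suc.prems[THEN Ck_on_has_derivative, OF this]]
    show "((\<lambda>x. B (f x) (g x)) has_derivative
       (\<lambda>v. B (f x) (frechet_derivative g (at x) v) + B (frechet_derivative f (at x) v) (g x))) (at x)" .
  next
    fix v
    have "Ck_on k f S" "Ck_on k g S" using Suc.prems by (blast intro: Ck_on_Suc_imp)+
    moreover have "Ck_on k (\<lambda>x. frechet_derivative f (at x) v) S"
        "Ck_on k (\<lambda>x. frechet_derivative g (at x) v) S" using Suc.prems by simp_all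
    ultimately show "Ck_on k (\<lambda>x. B (f x) (frechet_derivative g (at x) v) +
        B (frechet_derivative f (at x) v) (g x)) S"
      by (rule_tac Ck_on_add[OF assms(1)]; rule_tac Suc.IH)
  qed
qed

lemmas Ck_on_mult = Ck_on_bilinear[OF _ bounded_bilinear_mult]
lemmas Ck_on_scaleR = Ck_on_bilinear[OF _ bounded_bilinear_scaleR]

lemma Ck_on_diff:
  assumes "open S" "Ck_on k f S" "Ck_on k g S"
  shows "Ck_on k (\<lambda>x. f x - g x) S"
  using Ck_on_add[OF assms(1,2)
    Ck_on_linear_comp[OF assms(1) bounded_linear_minus[OF bounded_linear_ident] assms(3)]] by simp

lemma Ck_on_prod:
  fixes f :: "'i \<Rightarrow> 'a::real_normed_vector \<Rightarrow> real"
  assumes "open S" "\<And>i. i \<in> I \<Longrightarrow> Ck_on k (f i) S"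
  shows "Ck_on k (\<lambda>x. \<Prod>i\<in>I. f i x) S"
  using assms(2)
  by (induction I rule: infinite_finite_induct) (auto intro!: Ck_on_const Ck_on_mult[OF assms(1)])

lemma linear_expand_basis:
  fixes L :: "'a::euclidean_space \<Rightarrow> 'b::real_vector"
  assumes "linear L"
  shows "L w = (\<Sum>b\<in>Basis. (w \<bullet> b) *\<^sub>R L b)"
proof -
  have "L w = L (\<Sum>b\<in>Basis. (w \<bullet> b) *\<^sub>R b)"
    by (simp only: euclidean_representation)
  also have "\<dots> = (\<Sum>b\<in>Basis. L ((w \<bullet> b) *\<^sub>R b))"
    using assms by (rule linear_sum)
  also have "\<dots> = (\<Sum>b\<in>Basis. (w \<bullet> b) *\<^sub>R L b)"
    by (intro sum.cong refl linear_scale assms)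
  finally show ?thesis .
qed

text \<open>
  The chain rule expands the outer derivative over a basis, so that the induction only ever
  needs the directional derivatives of the outer map along fixed vectors.
\<close>

lemma Ck_on_compose:
  fixes f :: "'a::real_normed_vector \<Rightarrow> 'b::euclidean_space"
  assumes "open S" "open T" "f ` S \<subseteq> T" "Ck_on k f S" "Ck_on k g T"
  shows "Ck_on k (\<lambda>x. g (f x)) S"
  using assms(4,5)
proof (induction k arbitrary: g)
  case 0
  then show ?case using assms(3) by (simp add: continuous_on_compose2)
next
  case (Suc k)
  show ?case
  proof (rule Ck_on_Suc_has_derivative[OF assms(1)])
    fix x assume x: "x \<in> S"
    then have "f x \<in> T" using assms(3) by auto
    note g = Ck_on_has_derivative[OF Suc.prems(2) this]
    have lin: "linear (frechet_derivative g (at (f x)))"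
      by (rule has_derivative_linear[OF g])
    note expand = linear_expand_basis[OF lin]
    show "((\<lambda>x. g (f x)) has_derivative
       (\<lambda>v. \<Sum>b\<in>Basis. (frechet_derivative f (at x) v \<bullet> b) *\<^sub>R frechet_derivative g (at (f x)) b)) (at x)"
      by (rule has_derivative_eq_rhs[OF has_derivative_compose[OF Ck_on_has_derivative[OF Suc.prems(1) x] g]])
         (rule ext, rule expand)
  next
    fix v
    have "Ck_on k f S" by (rule Ck_on_Suc_imp[OF Suc.prems(1)])
    then have "Ck_on k (\<lambda>x. frechet_derivative g (at (f x)) b) S" for b
      using Suc.IH[of "\<lambda>y. frechet_derivative g (at y) b"] Suc.prems by simp
    moreover have "Ck_on k (\<lambda>x. frechet_derivative f (at x) v \<bullet> b) S" for b
      by (rule Ck_on_linear_comp[OF assms(1) bounded_linear_inner_left]) (use Suc.prems in simp)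
    ultimately show "Ck_on k (\<lambda>x. \<Sum>b\<in>Basis. (frechet_derivative f (at x) v \<bullet> b) *\<^sub>R
        frechet_derivative g (at (f x)) b) S"
      by (intro Ck_on_sum Ck_on_scaleR assms(1))
  qed
qed

lemma Ck_on_inverse: "Ck_on k (inverse :: real \<Rightarrow> real) (- {0})"
proof (induction k)
  case 0
  then show ?case by (auto intro!: continuous_intros)
next
  case (Suc k)
  have o: "open (- {0::real})" by (simp add: open_Compl)
  show ?case
  proof (rule Ck_on_Suc_has_derivative[OF o])
    fix x :: real assume "x \<in> - {0}"
    then show "(inverse has_derivative (\<lambda>v. - (inverse x * v * inverse x))) (at x)"
      by (intro has_derivative_inverse') simp
  next
    fix v
    have "Ck_on k (\<lambda>x::real. (- v) * (inverse x * inverse x)) (- {0})"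
      by (intro Ck_on_mult o Suc Ck_on_const)
    then show "Ck_on k (\<lambda>x. - (inverse x * v * inverse x)) (- {0})"
      by (simp add: mult_ac)
  qed
qed

lemma Ck_on_divide:
  fixes f g :: "'a::real_normed_vector \<Rightarrow> real"
  assumes "open S" "Ck_on k f S" "Ck_on k g S" "\<And>x. x \<in> S \<Longrightarrow> g x \<noteq> 0"
  shows "Ck_on k (\<lambda>x. f x / g x) S"
proof -
  have "Ck_on k (\<lambda>x. inverse (g x)) S"
    by (rule Ck_on_compose[OF assms(1) _ _ assms(3) Ck_on_inverse])
       (use assms(4) in \<open>auto simp: open_Compl\<close>)
  from Ck_on_mult[OF assms(1,2) this] show ?thesis by (simp add: field_simps)
qed

lemma Ck_on_Pair:
  assumes "open S" "Ck_on k f S" "Ck_on k g S"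
  shows "Ck_on k (\<lambda>x. (f x, g x)) S"
proof -
  have "Ck_on k (\<lambda>x. (f x, 0) + (0, g x)) S"
    by (intro Ck_on_add[OF assms(1)]
        Ck_on_linear_comp[OF assms(1) _ assms(2), of "\<lambda>y. (y, 0)"]
        Ck_on_linear_comp[OF assms(1) _ assms(3), of "\<lambda>y. (0, y)"]
        bounded_linear_Pair bounded_linear_ident bounded_linear_zero)
  then show ?thesis by simp
qed

lemma Ck_on_vec:
  fixes f :: "'n::finite \<Rightarrow> 'a::real_normed_vector \<Rightarrow> real"
  assumes "open S" "\<And>i. Ck_on k (f i) S"
  shows "Ck_on k (\<lambda>x. \<chi> i. f i x) S"
proof -
  have "Ck_on k (\<lambda>x. \<Sum>i\<in>UNIV. f i x *\<^sub>R axis i (1::real)) S"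
    by (intro Ck_on_sum Ck_on_scaleR assms Ck_on_const)
  moreover have "(\<Sum>i\<in>UNIV. f i x *\<^sub>R axis i (1::real)) = (\<chi> i. f i x)" for x
    by (simp add: vec_eq_iff sum_component axis_def if_distrib cong: if_cong)
  ultimately show ?thesis by simp
qed

lemma Ck_on_nth: "open S \<Longrightarrow> Ck_on k f S \<Longrightarrow> Ck_on k (\<lambda>x. f x $ i) S"
  by (rule Ck_on_linear_comp[OF _ bounded_linear_vec_nth])

lemma Ck_on_det:
  fixes M :: "'a::real_normed_vector \<Rightarrow> real^'n::finite^'n"
  assumes "open S" "\<And>i j. Ck_on k (\<lambda>x. M x $ i $ j) S"
  shows "Ck_on k (\<lambda>x. det (M x)) S"
  unfolding det_def
proof (rule Ck_on_sum[OF assms(1)], rule Ck_on_mult[OF assms(1)])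
  fix p :: "'n \<Rightarrow> 'n"
  show "Ck_on k (\<lambda>x. of_int (sign p) :: real) S" by (rule Ck_on_const)
  show "Ck_on k (\<lambda>x. \<Prod>i\<in>UNIV. M x $ i $ p i) S"
    by (rule Ck_on_prod[OF assms(1)]) (rule assms(2))
qed

text \<open>By Cramer's rule, the solution of a regular linear system is as smooth as its data.\<close>

lemma Ck_on_linear_solution:
  fixes M :: "'a::real_normed_vector \<Rightarrow> real^'n::finite^'n"
  assumes S: "open S" and M: "\<And>i j. Ck_on k (\<lambda>x. M x $ i $ j) S" and b: "Ck_on k b S"
    and sol: "\<And>x. x \<in> S \<Longrightarrow> M x *v s x = b x" and reg: "\<And>x. x \<in> S \<Longrightarrow> det (M x) \<noteq> 0"
  shows "Ck_on k s S"
proof (rule Ck_on_cong[OF S])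
  let ?s = "\<lambda>x. \<chi> l. det (\<chi> i j. if j = l then b x $ i else M x $ i $ j) / det (M x)"
  show "?s x = s x" if "x \<in> S" for x
    using cramer[OF reg[OF that], THEN iffD1, OF sol[OF that]] by simp
  show "Ck_on k ?s S"
  proof (rule Ck_on_vec[OF S], rule Ck_on_divide[OF S Ck_on_det[OF S] Ck_on_det[OF S M] reg], simp_all)
    fix i j l :: 'n
    show "Ck_on k (\<lambda>x. if j = l then b x $ i else M x $ i $ j) S"
      by (cases "j = l") (auto intro: M Ck_on_nth[OF S b])
  qed
qed

text \<open>
  Bootstrapping for implicitly defined maps: differentiating \<open>\<Phi> (x, y x) = \<phi> x\<close> expresses the
  derivative of \<open>y\<close> by a regular linear system whose coefficients are as smooth as \<open>y\<close> is, so
  every degree of smoothness of \<open>y\<close> yields the next one.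
\<close>

lemma smooth_on_implicit:
  fixes \<Phi> :: "'a::euclidean_space \<times> (real^'n::finite) \<Rightarrow> real^'n" and y :: "'a \<Rightarrow> real^'n"
  assumes S: "open S" and T: "open T" and \<Phi>: "smooth_on \<Phi> T" and \<phi>: "smooth_on \<phi> S"
    and y: "\<And>x. x \<in> S \<Longrightarrow> y differentiable (at x)" "\<And>x. x \<in> S \<Longrightarrow> (x, y x) \<in> T"
    and eq: "\<And>x. x \<in> S \<Longrightarrow> \<Phi> (x, y x) = \<phi> x"
    and reg: "\<And>x w. x \<in> S \<Longrightarrow> frechet_derivative \<Phi> (at (x, y x)) (0, w) = 0 \<Longrightarrow> w = 0"
  shows "smooth_on y S"
proof -
  let ?D = "\<lambda>x. frechet_derivative \<Phi> (at (x, y x))"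
  define M where "M x = matrix (\<lambda>w. ?D x (0, w))" for x
  have \<Phi>': "(\<Phi> has_derivative ?D x) (at (x, y x))" if "x \<in> S" for x
    using \<Phi> y(2)[OF that] unfolding smooth_on_def by (blast intro: Ck_on_has_derivative[of 0])
  have lin: "linear (\<lambda>w. ?D x (0, w))" if "x \<in> S" for x
  proof -
    have "linear (?D x \<circ> (\<lambda>w. (0, w)))"
      by (intro linear_compose has_derivative_linear[OF \<Phi>'[OF that]] linearI) auto
    then show ?thesis by (simp add: o_def)
  qed
  have M: "M x *v w = ?D x (0, w)" if "x \<in> S" for x w
    unfolding M_def using fun_cong[OF matrix_vector_mul(2)[OF lin[OF that]]] by simp
  have det: "det (M x) \<noteq> 0" if "x \<in> S" for x
  proof -
    have "inj ((*v) (M x))"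
      using M[OF that] reg[OF that] by (simp add: linear_injective_0)
    then show ?thesis using det_nz_iff_inj[of "(*v) (M x)"] by simp
  qed
  have y': "(y has_derivative frechet_derivative y (at x)) (at x)" if "x \<in> S" for x
    using y(1)[OF that] frechet_derivative_works by blast
  have system: "M x *v frechet_derivative y (at x) v = frechet_derivative \<phi> (at x) v - ?D x (v, 0)"
    if x: "x \<in> S" for x v
  proof -
    have "((\<lambda>x. (x, y x)) has_derivative (\<lambda>v. (v, frechet_derivative y (at x) v))) (at x)"
      by (intro has_derivative_Pair has_derivative_ident y'[OF x])
    from has_derivative_compose[OF this \<Phi>'[OF x]]
    have "((\<lambda>x. \<Phi> (x, y x)) has_derivative (\<lambda>v. ?D x (v, frechet_derivative y (at x) v))) (at x)" .
    then have "(\<phi> has_derivative (\<lambda>v. ?D x (v, frechet_derivative y (at x) v))) (at x)"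
      by (rule has_derivative_transform_within_open[OF _ S x]) (rule eq)
    then have "frechet_derivative \<phi> (at x) v = ?D x (v, frechet_derivative y (at x) v)"
      by (rule fun_cong[OF frechet_derivative_at, symmetric])
    also have "\<dots> = ?D x (v, 0) + ?D x (0, frechet_derivative y (at x) v)"
      using linear_add[OF has_derivative_linear[OF \<Phi>'[OF x]], of "(v, 0)" "(0, frechet_derivative y (at x) v)"]
      by (simp only: add_Pair add_0 add_0_right)
    finally show ?thesis using M[OF x] by simp
  qed
  have "Ck_on k y S" for k
  proof (induction k)
    case 0
    then show ?case
      using y(1) unfolding Ck_on.simps
      by (intro continuous_at_imp_continuous_on) (blast intro: differentiable_imp_continuous_within)
  next
    case (Suc k)
    have pair: "Ck_on k (\<lambda>x. (x, y x)) S"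
      by (rule Ck_on_Pair[OF S Ck_on_linear[OF S bounded_linear_ident] Suc])
    have D: "Ck_on k (\<lambda>x. ?D x v) S" for v
    proof (rule Ck_on_compose[OF S T _ pair, where g = "\<lambda>z. frechet_derivative \<Phi> (at z) v"])
      show "(\<lambda>x. (x, y x)) ` S \<subseteq> T" using y(2) by auto
      have "Ck_on (Suc k) \<Phi> T" using \<Phi> unfolding smooth_on_def by (rule spec)
      then show "Ck_on k (\<lambda>z. frechet_derivative \<Phi> (at z) v) T"
        by (rule Ck_on_frechet_derivative)
    qed
    have "Ck_on k (\<lambda>x. frechet_derivative y (at x) v) S" for v
    proof (rule Ck_on_linear_solution[OF S _ _ system det])
      show "Ck_on k (\<lambda>x. M x $ i $ j) S" for i j
        unfolding M_def matrix_def using Ck_on_nth[OF S D] by simp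
      have "Ck_on (Suc k) \<phi> S" using \<phi> unfolding smooth_on_def by (rule spec)
      then have "Ck_on k (\<lambda>x. frechet_derivative \<phi> (at x) v) S" by simp
      then show "Ck_on k (\<lambda>x. frechet_derivative \<phi> (at x) v - ?D x (v, 0)) S"
        by (rule Ck_on_diff[OF S _ D])
    qed
    then show ?case using y(1) by simp
  qed
  then show ?thesis by (simp add: smooth_on_def)
qed

lemma smooth_on_has_derivative:
  "smooth_on f S \<Longrightarrow> x \<in> S \<Longrightarrow> (f has_derivative frechet_derivative f (at x)) (at x)"
  unfolding smooth_on_def by (blast intro: Ck_on_has_derivative[of 0])

lemma smooth_on_frechet_derivative:
  assumes "smooth_on f S" shows "smooth_on (\<lambda>x. frechet_derivative f (at x) v) S"
  unfolding smooth_on_def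
proof
  fix k
  have "Ck_on (Suc k) f S" using assms unfolding smooth_on_def by (rule spec)
  then show "Ck_on k (\<lambda>x. frechet_derivative f (at x) v) S"
    by (rule Ck_on_frechet_derivative)
qed


section \<open>Charts and tangent vectors\<close>

locale smooth_manifold =
  fixes Atl :: "('m::{t2_space, second_countable_topology}, 'n::finite) chart set"
  assumes atlas: "smooth_atlas Atl"
begin

lemma chart_at: "chart_at Atl p \<in> Atl" "p \<in> fst (chart_at Atl p)"
proof -
  have "\<exists>c. c \<in> Atl \<and> p \<in> fst c" using atlas unfolding smooth_atlas_def by blast
  from someI_ex[OF this] show "chart_at Atl p \<in> Atl" "p \<in> fst (chart_at Atl p)"
    unfolding chart_at_def by auto
qed

lemma chart_homeomorphism:
  assumes "c \<in> Atl"
  shows "homeomorphism (fst c) (snd c ` fst c) (snd c) (cinv c)"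
  using atlas assms unfolding smooth_atlas_def by blast

lemma open_chart: "c \<in> Atl \<Longrightarrow> open (fst c)" "c \<in> Atl \<Longrightarrow> open (snd c ` fst c)"
  using atlas unfolding smooth_atlas_def by blast+

lemma cinv_chart [simp]: "c \<in> Atl \<Longrightarrow> p \<in> fst c \<Longrightarrow> cinv c (snd c p) = p"
  using chart_homeomorphism[of c] unfolding homeomorphism_def by blast

lemma continuous_on_chart: "c \<in> Atl \<Longrightarrow> continuous_on (fst c) (snd c)"
  using chart_homeomorphism[of c] unfolding homeomorphism_def by blast

lemma open_chart_image:
  assumes "c \<in> Atl" "open V"
  shows "open (snd c ` (V \<inter> fst c))"
proof -
  have "openin (top_of_set (fst c)) (V \<inter> fst c)"
    using assms(2) by (metis Int_commute openin_open_Int)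
  from homeomorphism_imp_open_map[OF chart_homeomorphism[OF assms(1)] this]
  show ?thesis using openin_open_trans open_chart(2)[OF assms(1)] by blast
qed

lemma has_derivative_transition:
  assumes "c \<in> Atl" "c' \<in> Atl" "p \<in> fst c" "p \<in> fst c'"
  shows "(snd c' \<circ> cinv c has_derivative frechet_derivative (snd c' \<circ> cinv c) (at (snd c p)))
           (at (snd c p))"
proof (rule smooth_on_has_derivative)
  show "smooth_on (snd c' \<circ> cinv c) (snd c ` (fst c \<inter> fst c'))"
    using atlas assms(1,2) unfolding smooth_atlas_def by blast
  show "snd c p \<in> snd c ` (fst c \<inter> fst c')" using assms(3,4) by auto
qed

text \<open>
  For \<open>g\<close> a chart map this is the cocycle rule of the transition maps; for \<open>g\<close> a function it expresses
  its differential in an arbitrary chart.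
\<close>

lemma frechet_derivative_through_chart:
  assumes c: "c \<in> Atl" "c' \<in> Atl" "p \<in> fst c" "p \<in> fst c'"
    and g: "(g \<circ> cinv c') differentiable (at (snd c' p))"
  shows "(g \<circ> cinv c has_derivative
     (\<lambda>v. frechet_derivative (g \<circ> cinv c') (at (snd c' p))
            (frechet_derivative (snd c' \<circ> cinv c) (at (snd c p)) v))) (at (snd c p))"
proof (rule has_derivative_transform_within_open)
  have "(g \<circ> cinv c' has_derivative frechet_derivative (g \<circ> cinv c') (at (snd c' p)))
      (at ((snd c' \<circ> cinv c) (snd c p)))"
    using g c by (simp add: frechet_derivative_works)
  from has_derivative_compose[OF has_derivative_transition[OF c] this]
  show "((\<lambda>x. (g \<circ> cinv c') ((snd c' \<circ> cinv c) x)) has_derivative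
     (\<lambda>v. frechet_derivative (g \<circ> cinv c') (at (snd c' p))
            (frechet_derivative (snd c' \<circ> cinv c) (at (snd c p)) v))) (at (snd c p))" .
  show "open (snd c ` (fst c' \<inter> fst c))" using open_chart_image[OF c(1) open_chart(1)[OF c(2)]] .
  show "snd c p \<in> snd c ` (fst c' \<inter> fst c)" using c by auto
  show "(g \<circ> cinv c') ((snd c' \<circ> cinv c) x) = (g \<circ> cinv c) x"
    if "x \<in> snd c ` (fst c' \<inter> fst c)" for x
    using that c by auto
qed

lemma frechet_derivative_chart_self:
  assumes "c \<in> Atl" "p \<in> fst c"
  shows "frechet_derivative (snd c \<circ> cinv c) (at (snd c p)) v = v"
proof -
  have "(snd c \<circ> cinv c has_derivative (\<lambda>v. v)) (at (snd c p))"
    by (rule has_derivative_transform_within_open[OF has_derivative_ident open_chart(2)[OF assms(1)]])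
       (use assms in auto)
  from frechet_derivative_at[OF this] show ?thesis by metis
qed

lemma dchart_chart_at [simp]: "dchart Atl (chart_at Atl p) p v = v"
  unfolding dchart_def by (rule frechet_derivative_chart_self[OF chart_at])

lemma linear_dchart:
  assumes "c \<in> Atl" "p \<in> fst c" shows "linear (dchart Atl c p)"
  unfolding dchart_def
  by (rule has_derivative_linear[OF has_derivative_transition[OF chart_at(1) assms(1) chart_at(2) assms(2)]])

lemma dchart_bij:
  assumes c: "c \<in> Atl" "p \<in> fst c" shows "bij (dchart Atl c p)"
proof -
  let ?c = "chart_at Atl p"
  let ?B = "frechet_derivative (snd ?c \<circ> cinv c) (at (snd c p))"
  note chain = frechet_derivative_through_chart[THEN frechet_derivative_at, symmetric, THEN fun_cong]
  have *: "(snd c' \<circ> cinv c'') differentiable (at (snd c'' p))"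
    if "c' \<in> Atl" "p \<in> fst c'" "c'' \<in> Atl" "p \<in> fst c''" for c' c''
    by (rule differentiableI[OF has_derivative_transition]) (use that in auto)
  have "?B (dchart Atl c p v) = v" for v
    using chain[OF chart_at(1) c(1) chart_at(2) c(2) *, of ?c v] chart_at c
      frechet_derivative_chart_self[OF chart_at, of p v] unfolding dchart_def by metis
  moreover have "dchart Atl c p (?B w) = w" for w
    using chain[OF c(1) chart_at(1) c(2) chart_at(2) *, of c w] chart_at c
      frechet_derivative_chart_self[OF c, of w] unfolding dchart_def by metis
  ultimately show ?thesis by (rule o_bij[unfolded o_def id_def fun_eq_iff, rule_format])
qed

lemma dchart_eq_0_iff: "c \<in> Atl \<Longrightarrow> p \<in> fst c \<Longrightarrow> dchart Atl c p v = 0 \<longleftrightarrow> v = 0"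
  using dchart_bij[of c p] linear_dchart[of c p] by (metis bij_is_inj injD linear_0)

lemma dchart_surj:
  assumes "c \<in> Atl" "p \<in> fst c" obtains v where "dchart Atl c p v = w"
  using dchart_bij[OF assms] by (metis bij_pointE)

lemma tchart_inv_tchart:
  assumes "c \<in> Atl" "p \<in> fst c"
  shows "tchart_inv Atl c (snd c p, dchart Atl c p v) = (p, v)"
proof -
  have "inj_on (tchart Atl c) (fst c \<times> UNIV)"
  proof (rule inj_onI, clarify)
    fix q u q' u'
    assume q: "q \<in> fst c" "q' \<in> fst c" "tchart Atl c (q, u) = tchart Atl c (q', u')"
    then have "q = q'" using assms(1) unfolding tchart_def by (metis cinv_chart prod.case prod.inject)
    with q dchart_bij[OF assms(1) q(1)] show "q = q' \<and> u = u'"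
      unfolding tchart_def by (auto dest: bij_is_inj injD)
  qed
  from inv_into_f_f[OF this, of "(p, v)"] assms show ?thesis
    by (simp add: tchart_inv_def tchart_def)
qed

lemma differential_chart:
  assumes c: "c \<in> Atl" "p \<in> fst c" and g: "(g \<circ> cinv c) differentiable (at (snd c p))"
  shows "differential Atl g p u = frechet_derivative (g \<circ> cinv c) (at (snd c p)) (dchart Atl c p u)"
  using frechet_derivative_at[OF frechet_derivative_through_chart[OF chart_at(1) c(1) chart_at(2) c(2) g]]
  unfolding differential_def dchart_def by metis

lemma smooth_fun_has_derivative:
  assumes "smooth_fun_on Atl U f" "c \<in> Atl" "p \<in> U" "p \<in> fst c"
  shows "(f \<circ> cinv c has_derivative frechet_derivative (f \<circ> cinv c) (at (snd c p))) (at (snd c p))"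
  by (rule smooth_on_has_derivative) (use assms in \<open>auto simp: smooth_fun_on_def\<close>)

lemma vf_rep_chart: "c \<in> Atl \<Longrightarrow> p \<in> fst c \<Longrightarrow> vf_rep Atl c X (snd c p) = dchart Atl c p (X p)"
  by (simp add: vf_rep_def)

lemma smooth_vf_differentiable:
  assumes "smooth_vf_on Atl U X" "c \<in> Atl" "p \<in> U" "p \<in> fst c"
  shows "vf_rep Atl c X differentiable (at (snd c p))"
  by (rule differentiableI, rule smooth_on_has_derivative) (use assms in \<open>auto simp: smooth_vf_on_def\<close>)

end


section \<open>The divergence in coordinates\<close>

lemma det_coordinate_frame: "det ((\<chi> j. axis j 1) :: real^'n::finite^'n) = 1"
proof -
  have "((\<chi> j. axis j 1) :: real^'n^'n) = mat 1"
    by (auto simp: mat_def axis_def vec_eq_iff)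
  then show ?thesis by (simp add: det_I)
qed

lemma det_identity_replace_row:
  "det (\<chi> j. if j = i then w else axis j 1) = (w $ i :: real)" for w :: "real^'n::finite"
proof -
  have row: "row j (mat 1 :: real^'n^'n) = axis j 1" for j
    by (simp add: row_def mat_def axis_def vec_eq_iff eq_commute)
  from cramer_lemma_transpose[where x = w and k = i and A = "mat 1 :: real^'n^'n"] show ?thesis
    unfolding row basis_expansion by (simp add: det_I)
qed

lemma linear_componentwise_sum:
  fixes L :: "real^'n::finite \<Rightarrow> real"
  assumes "linear L" shows "(\<Sum>i\<in>UNIV. w $ i * L (axis i 1)) = L w"
proof -
  have "L w = L (\<Sum>i\<in>UNIV. w $ i *\<^sub>R axis i 1)"
    using basis_expansion[of w] by (simp add: scalar_mult_eq_scaleR)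
  also have "\<dots> = (\<Sum>i\<in>UNIV. w $ i * L (axis i 1))"
    by (simp add: linear_sum[OF assms] linear_scale[OF assms])
  finally show ?thesis by simp
qed

text \<open>
  On the coordinate frame the brackets are the negative columns of the Jacobian matrix of \<open>X\<close>, so the
  Lie derivative produces its trace.
\<close>

lemma lie_derivative_top_coordinates:
  fixes X :: "real^'n::finite \<Rightarrow> real^'n"
  shows "lie_derivative_top X (local_top_form \<nu> c) (\<lambda>i y. axis i 1) x =
    frechet_derivative (\<nu> c \<circ> cinv c) (at x) (X x)
    + \<nu> c (cinv c x) * (\<Sum>i\<in>UNIV. frechet_derivative X (at x) (axis i 1) $ i)"
proof -
  note I = det_coordinate_frame[where 'n='n]
  have "(\<lambda>y. local_top_form \<nu> c y (\<chi> j. axis j 1)) = \<nu> c \<circ> cinv c"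
    by (simp add: local_top_form_def I fun_eq_iff)
  moreover have "bracket X (\<lambda>y. axis i 1) x = - frechet_derivative X (at x) (axis i 1)" for i
    by (simp add: bracket_def frechet_derivative_const)
  ultimately show ?thesis
    by (simp add: lie_derivative_top_def local_top_form_def det_identity_replace_row
        sum_negf sum_distrib_left)
qed

context smooth_manifold
begin

lemma divergence_coordinates:
  defines "c \<equiv> \<lambda>p. chart_at Atl p"
  assumes \<nu>: "volume_form Atl \<nu>"
  shows "divergence Atl \<nu> X p =
     frechet_derivative (\<nu> (c p) \<circ> cinv (c p)) (at (snd (c p) p)) (X p) / \<nu> (c p) p
     + (\<Sum>i\<in>UNIV. frechet_derivative (vf_rep Atl (c p) X) (at (snd (c p) p)) (axis i 1) $ i)"
proof -
  note I = det_coordinate_frame[where 'n='n]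
  have "\<nu> (c p) p > 0" using \<nu> chart_at unfolding volume_form_def c_def by blast
  then show ?thesis using chart_at[of p]
    by (simp add: divergence_def Let_def lie_derivative_top_coordinates c_def[symmetric]
        local_top_form_def I vf_rep_chart add_divide_distrib) (simp add: c_def)
qed

lemma volume_form_has_derivative:
  assumes "volume_form Atl \<nu>" "c \<in> Atl" "p \<in> fst c"
  shows "(\<nu> c \<circ> cinv c has_derivative frechet_derivative (\<nu> c \<circ> cinv c) (at (snd c p))) (at (snd c p))"
  by (rule smooth_on_has_derivative) (use assms in \<open>auto simp: volume_form_def\<close>)

lemma has_derivative_vf_rep:
  assumes "c \<in> Atl" "open V" "p \<in> V" "p \<in> fst c"
    and "\<And>q. q \<in> V \<Longrightarrow> q \<in> fst c \<Longrightarrow> dchart Atl c q (X q) = Y (snd c q)"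
    and "(Y has_derivative D) (at (snd c p))"
  shows "(vf_rep Atl c X has_derivative D) (at (snd c p))"
  by (rule has_derivative_transform_within_open[OF assms(6) open_chart_image[OF assms(1,2)]])
     (use assms in \<open>auto simp: vf_rep_chart\<close>)

lemma differentiable_vf_rep:
  assumes "c \<in> Atl" "p \<in> fst c" "\<And>q. q \<in> fst c \<Longrightarrow> dchart Atl c q (X q) = Y (snd c q)"
    and "Y differentiable (at (snd c p))"
  shows "vf_rep Atl c X differentiable (at (snd c p))"
proof -
  obtain D where D: "(Y has_derivative D) (at (snd c p))" using assms(4) unfolding differentiable_def by blast
  have "(vf_rep Atl c X has_derivative D) (at (snd c p))"
    by (rule has_derivative_vf_rep[OF assms(1) open_UNIV UNIV_I assms(2) _ D]) (rule assms(3))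
  then show ?thesis by (rule differentiableI)
qed

lemma divergence_cong:
  assumes "volume_form Atl \<nu>" "open V" "p \<in> V" "\<And>q. q \<in> V \<Longrightarrow> X q = Y q"
    and Y: "vf_rep Atl (chart_at Atl p) Y differentiable (at (snd (chart_at Atl p) p))"
  shows "divergence Atl \<nu> X p = divergence Atl \<nu> Y p"
proof -
  let ?c = "chart_at Atl p"
  have "(vf_rep Atl ?c X has_derivative frechet_derivative (vf_rep Atl ?c Y) (at (snd ?c p))) (at (snd ?c p))"
    by (rule has_derivative_vf_rep[OF chart_at(1) assms(2,3) chart_at(2),
        where Y="vf_rep Atl (chart_at Atl p) Y"])
       (use Y assms(4) chart_at in \<open>simp_all add: frechet_derivative_works vf_rep_chart\<close>)
  from frechet_derivative_at[OF this] assms(3,4) show ?thesis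
    by (simp add: divergence_coordinates[OF assms(1)])
qed

lemma divergence_add:
  assumes \<nu>: "volume_form Atl \<nu>"
    and X: "vf_rep Atl (chart_at Atl p) X differentiable (at (snd (chart_at Atl p) p))"
    and Y: "vf_rep Atl (chart_at Atl p) Y differentiable (at (snd (chart_at Atl p) p))"
  shows "divergence Atl \<nu> (\<lambda>q. X q + Y q) p = divergence Atl \<nu> X p + divergence Atl \<nu> Y p"
proof -
  let ?c = "chart_at Atl p"
  let ?x = "snd ?c p"
  have "(vf_rep Atl ?c (\<lambda>q. X q + Y q) has_derivative
      (\<lambda>v. frechet_derivative (vf_rep Atl ?c X) (at ?x) v + frechet_derivative (vf_rep Atl ?c Y) (at ?x) v)) (at ?x)"
  proof (rule has_derivative_vf_rep[OF chart_at(1) open_UNIV _ chart_at(2)])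
    show "((\<lambda>x. vf_rep Atl ?c X x + vf_rep Atl ?c Y x) has_derivative
      (\<lambda>v. frechet_derivative (vf_rep Atl ?c X) (at ?x) v + frechet_derivative (vf_rep Atl ?c Y) (at ?x) v)) (at ?x)"
      by (intro has_derivative_add) (use X Y in \<open>simp_all add: frechet_derivative_works\<close>)
  qed (use chart_at in \<open>auto simp: vf_rep_chart linear_add[OF linear_dchart]\<close>)
  note der = frechet_derivative_at[OF this, symmetric]
  have "linear (frechet_derivative (\<nu> ?c \<circ> cinv ?c) (at ?x))"
    using volume_form_has_derivative[OF \<nu> chart_at] has_derivative_linear by blast
  then show ?thesis
    by (simp add: divergence_coordinates[OF \<nu>] der sum.distrib linear_add add_divide_distrib)
qed

lemma divergence_scaleR:
  assumes \<nu>: "volume_form Atl \<nu>"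
    and X: "vf_rep Atl (chart_at Atl p) X differentiable (at (snd (chart_at Atl p) p))"
    and h: "differentiable_at Atl h p"
  shows "divergence Atl \<nu> (\<lambda>q. h q *\<^sub>R X q) p = h p * divergence Atl \<nu> X p + differential Atl h p (X p)"
proof -
  let ?c = "chart_at Atl p"
  let ?x = "snd ?c p"
  let ?X' = "frechet_derivative (vf_rep Atl ?c X) (at ?x)"
  have "(vf_rep Atl ?c (\<lambda>q. h q *\<^sub>R X q) has_derivative
      (\<lambda>v. h p *\<^sub>R ?X' v + differential Atl h p v *\<^sub>R X p)) (at ?x)"
  proof (rule has_derivative_vf_rep[OF chart_at(1) open_UNIV _ chart_at(2)])
    have "((\<lambda>x. (h \<circ> cinv ?c) x *\<^sub>R vf_rep Atl ?c X x) has_derivative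
      (\<lambda>v. (h \<circ> cinv ?c) ?x *\<^sub>R ?X' v + differential Atl h p v *\<^sub>R vf_rep Atl ?c X ?x)) (at ?x)"
      unfolding differential_def
      by (intro has_derivative_scaleR) (use X h in \<open>simp_all add: frechet_derivative_works differentiable_at_def o_def\<close>)
    then show "((\<lambda>x. (h \<circ> cinv ?c) x *\<^sub>R vf_rep Atl ?c X x) has_derivative
      (\<lambda>v. h p *\<^sub>R ?X' v + differential Atl h p v *\<^sub>R X p)) (at ?x)"
      using chart_at by (simp add: vf_rep_chart)
  qed (use chart_at in \<open>auto simp: vf_rep_chart linear_scale[OF linear_dchart]\<close>)
  note der = frechet_derivative_at[OF this, symmetric]
  have lin: "linear (frechet_derivative (\<nu> ?c \<circ> cinv ?c) (at ?x))"
    using volume_form_has_derivative[OF \<nu> chart_at] has_derivative_linear by blast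
  have "linear (differential Atl h p)"
    using h frechet_derivative_works has_derivative_linear unfolding differentiable_at_def differential_def by blast
  from linear_componentwise_sum[OF this, of "X p"]
  have "(\<Sum>i\<in>UNIV. differential Atl h p (axis i 1) * X p $ i) = differential Atl h p (X p)"
    by (simp add: mult.commute)
  then show ?thesis
    by (simp add: divergence_coordinates[OF \<nu>] der sum.distrib linear_scale[OF lin]
        sum_distrib_left distrib_left)
qed

end


section \<open>The energy of a conic Finsler metric in bundle charts\<close>

lemma has_derivative_along_line:
  assumes "(f has_derivative f') (at z)"
  shows "((\<lambda>t. f (z + t *\<^sub>R d)) has_vector_derivative f' d) (at (0::real))"
proof -
  have "((\<lambda>t. z + t *\<^sub>R d) has_derivative (\<lambda>t. t *\<^sub>R d)) (at 0)"
    by (auto intro!: derivative_eq_intros)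
  moreover have "(f has_derivative f') (at (z + 0 *\<^sub>R d))" using assms by simp
  ultimately have "((\<lambda>t. f (z + t *\<^sub>R d)) has_derivative (\<lambda>t. f' (t *\<^sub>R d))) (at 0)"
    by (rule has_derivative_compose)
  then show ?thesis
    by (simp add: has_vector_derivative_def linear_scale[OF has_derivative_linear[OF assms]])
qed

lemma has_real_derivative_along_line:
  fixes f :: "'a::real_normed_vector \<Rightarrow> real"
  assumes "(f has_derivative f') (at z)"
  shows "((\<lambda>t. f (z + t *\<^sub>R d)) has_real_derivative f' d) (at 0)"
  using has_derivative_along_line[OF assms] by (simp add: has_real_derivative_iff_has_vector_derivative)

lemma DERIV_transfer_ev:
  fixes f g :: "real \<Rightarrow> real"
  assumes "(f has_real_derivative D) (at x)" "\<forall>\<^sub>F t in nhds x. g t = f t"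
  shows "(g has_real_derivative D) (at x)"
  using DERIV_cong_ev[OF refl assms(2) refl] assms(1) by blast

lemma has_vector_derivative_transfer_ev:
  assumes "(f has_vector_derivative D) (at x)" "\<forall>\<^sub>F t in nhds x. f t = g t"
  shows "(g has_vector_derivative D) (at x)"
proof -
  obtain S where "open S" "x \<in> S" "\<And>t. t \<in> S \<Longrightarrow> f t = g t"
    using assms(2) by (auto simp: eventually_nhds)
  from has_vector_derivative_transform_within_open[OF assms(1) this] show ?thesis .
qed

lemma eventually_line:
  fixes z d :: "'a::real_normed_vector"
  assumes "open S" "z \<in> S"
  shows "\<forall>\<^sub>F t in nhds (0::real). z + t *\<^sub>R d \<in> S"
proof -
  have "open ((\<lambda>t. z + t *\<^sub>R d) -` S)"
    using assms(1) by (intro open_vimage continuous_intros)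
  then show ?thesis
    using assms(2) eventually_nhds_in_open[of "(\<lambda>t. z + t *\<^sub>R d) -` S" 0] by simp
qed

lemma eventually_greater_neg: "(\<forall>\<^sub>F t in nhds (0::real). t > - \<delta>)" if "\<delta> > 0"
  using eventually_nhds_in_open[of "{-\<delta><..}" 0] that by (auto elim: eventually_mono)

locale conic_metric = smooth_manifold Atl
  for Atl :: "('m::{t2_space, second_countable_topology}, 'n::finite) chart set" +
  fixes A :: "('m \<times> (real^'n)) set" and F :: "'m \<Rightarrow> real^'n \<Rightarrow> real"
  assumes metric: "conic_finsler_metric Atl A F"
begin

lemma conic_metric_axioms:
  shows "open_TM Atl A" "smooth_TM_on Atl {(p, v) \<in> A. v \<noteq> 0} F"
    and "\<forall>p v r. (p, v) \<in> A \<longrightarrow> r > 0 \<longrightarrow> (p, r *\<^sub>R v) \<in> A"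
    and "\<forall>p v. (p, v) \<in> A \<longrightarrow> F p v \<ge> 0"
    and "\<forall>p v r. (p, v) \<in> A \<longrightarrow> r > 0 \<longrightarrow> F p (r *\<^sub>R v) = r * F p v"
    and "\<forall>p v. (p, v) \<in> A \<longrightarrow> v \<noteq> 0 \<longrightarrow> (\<forall>u. u \<noteq> 0 \<longrightarrow> fund_tensor F p v u u > 0)"
proof -
  note m = metric[unfolded conic_finsler_metric_def]
  show "open_TM Atl A" using m by (elim conjE)
  show "smooth_TM_on Atl {(p, v) \<in> A. v \<noteq> 0} F" using m by (elim conjE)
  show "\<forall>p v r. (p, v) \<in> A \<longrightarrow> r > 0 \<longrightarrow> (p, r *\<^sub>R v) \<in> A" using m by (elim conjE)
  show "\<forall>p v. (p, v) \<in> A \<longrightarrow> F p v \<ge> 0" using m by (elim conjE)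
  show "\<forall>p v r. (p, v) \<in> A \<longrightarrow> r > 0 \<longrightarrow> F p (r *\<^sub>R v) = r * F p v" using m by (elim conjE)
  show "\<forall>p v. (p, v) \<in> A \<longrightarrow> v \<noteq> 0 \<longrightarrow> (\<forall>u. u \<noteq> 0 \<longrightarrow> fund_tensor F p v u u > 0)"
    using m by (elim conjE)
qed

definition slit_domain :: "('m, 'n) chart \<Rightarrow> ((real^'n) \<times> (real^'n)) set" where
  "slit_domain c = tchart Atl c ` ({(p, v) \<in> A. v \<noteq> 0} \<inter> fst c \<times> UNIV)"

definition energy :: "('m, 'n) chart \<Rightarrow> (real^'n) \<times> (real^'n) \<Rightarrow> real" where
  "energy c z = (case_prod F (tchart_inv Atl c z))\<^sup>2 / 2"

text \<open>The Legendre transformation: the fiber derivative of the energy, as a vector.\<close>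

definition legendre :: "('m, 'n) chart \<Rightarrow> (real^'n) \<times> (real^'n) \<Rightarrow> real^'n" where
  "legendre c z = (\<chi> i. frechet_derivative (energy c) (at z) (0, axis i 1))"

abbreviation legendre' ::
  "('m, 'n) chart \<Rightarrow> (real^'n) \<times> (real^'n) \<Rightarrow> (real^'n) \<times> (real^'n) \<Rightarrow> real^'n" where
  "legendre' c z \<equiv> frechet_derivative (legendre c) (at z)"

lemma slit_domainE:
  assumes "z \<in> slit_domain c"
  obtains p v where "z = (snd c p, dchart Atl c p v)" "p \<in> fst c" "(p, v) \<in> A" "v \<noteq> 0"
proof -
  from assms obtain a where a: "z = tchart Atl c a" "a \<in> {(p, v) \<in> A. v \<noteq> 0} \<inter> fst c \<times> UNIV"
    unfolding slit_domain_def by (rule imageE)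
  obtain p v where "a = (p, v)" by (rule prod.exhaust)
  with a show ?thesis by (intro that[of p v]) (simp_all add: tchart_def)
qed

lemma slit_domain_iff [simp]:
  assumes "c \<in> Atl" "p \<in> fst c"
  shows "(snd c p, dchart Atl c p v) \<in> slit_domain c \<longleftrightarrow> (p, v) \<in> A \<and> v \<noteq> 0"
proof
  assume "(snd c p, dchart Atl c p v) \<in> slit_domain c"
  then obtain q w where q: "(snd c p, dchart Atl c p v) = (snd c q, dchart Atl c q w)"
    "q \<in> fst c" "(q, w) \<in> A" "w \<noteq> 0"
    by (rule slit_domainE)
  from tchart_inv_tchart[OF assms, of v] tchart_inv_tchart[OF assms(1) q(2), of w] q(1)
  have "(p, v) = (q, w)" by (simp only:)
  then show "(p, v) \<in> A \<and> v \<noteq> 0" using q by simp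
next
  assume "(p, v) \<in> A \<and> v \<noteq> 0"
  then have "(p, v) \<in> {(p, v) \<in> A. v \<noteq> 0} \<inter> fst c \<times> UNIV" using assms by simp
  then have "tchart Atl c (p, v) \<in> slit_domain c" unfolding slit_domain_def by (rule imageI)
  then show "(snd c p, dchart Atl c p v) \<in> slit_domain c" by (simp add: tchart_def)
qed

lemma slit_domain_chart_at [simp]:
  "(snd (chart_at Atl p) p, v) \<in> slit_domain (chart_at Atl p) \<longleftrightarrow> (p, v) \<in> A \<and> v \<noteq> 0"
  using slit_domain_iff[OF chart_at, of p v] by simp

lemma open_slit_domain:
  assumes "c \<in> Atl" shows "open (slit_domain c)"
proof -
  have "slit_domain c = tchart Atl c ` (A \<inter> fst c \<times> UNIV) \<inter> (UNIV \<times> - {0})" (is "_ = ?R")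
  proof (intro set_eqI iffI)
    fix z assume "z \<in> slit_domain c"
    then obtain p v where p: "z = (snd c p, dchart Atl c p v)" "p \<in> fst c" "(p, v) \<in> A" "v \<noteq> 0"
      by (rule slit_domainE)
    then have "tchart Atl c (p, v) \<in> tchart Atl c ` (A \<inter> fst c \<times> UNIV)" by (intro imageI) simp
    with p show "z \<in> ?R" using dchart_eq_0_iff[OF assms p(2)] by (simp add: tchart_def)
  next
    fix z assume z: "z \<in> ?R"
    then obtain a where a: "z = tchart Atl c a" "a \<in> A \<inter> fst c \<times> UNIV" by blast
    obtain p v where "a = (p, v)" by (rule prod.exhaust)
    with a z show "z \<in> slit_domain c" using dchart_eq_0_iff[OF assms, of p v]
      by (simp add: tchart_def assms)
  qed
  moreover have "open (tchart Atl c ` (A \<inter> fst c \<times> UNIV))"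
    by (rule bspec[OF conic_metric_axioms(1)[unfolded open_TM_def] assms])
  ultimately show ?thesis by (auto intro!: open_Int open_Times)
qed

lemma smooth_metric_chart:
  "c \<in> Atl \<Longrightarrow> smooth_on (case_prod F \<circ> tchart_inv Atl c) (slit_domain c)"
  unfolding slit_domain_def by (rule bspec[OF conic_metric_axioms(2)[unfolded smooth_TM_on_def]])

lemma smooth_energy:
  assumes "c \<in> Atl" shows "smooth_on (energy c) (slit_domain c)"
  unfolding smooth_on_def
proof
  fix k
  let ?F = "case_prod F \<circ> tchart_inv Atl c"
  have "Ck_on k ?F (slit_domain c)" using smooth_metric_chart[OF assms] unfolding smooth_on_def by (rule spec)
  note Ck_on_mult[OF open_slit_domain[OF assms] Ck_on_const Ck_on_mult[OF open_slit_domain[OF assms] this this], of "1/2"]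
  then show "Ck_on k (energy c) (slit_domain c)"
    by (rule Ck_on_cong[OF open_slit_domain[OF assms], rotated]) (simp add: energy_def power2_eq_square)
qed

lemmas energy_has_derivative = smooth_on_has_derivative[OF smooth_energy]

lemma smooth_legendre:
  assumes "c \<in> Atl" shows "smooth_on (legendre c) (slit_domain c)"
  unfolding smooth_on_def legendre_def[abs_def]
  by (intro allI, rule Ck_on_vec[OF open_slit_domain[OF assms]])
     (rule spec[OF smooth_on_frechet_derivative[OF smooth_energy[OF assms], unfolded smooth_on_def]])

lemmas legendre_has_derivative = smooth_on_has_derivative[OF smooth_legendre]

lemma legendre_inner:
  assumes "c \<in> Atl" "z \<in> slit_domain c"
  shows "legendre c z \<bullet> w = frechet_derivative (energy c) (at z) (0, w)"
proof -
  have "linear (frechet_derivative (energy c) (at z) \<circ> (\<lambda>w. (0, w)))"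
    by (intro linear_compose has_derivative_linear[OF energy_has_derivative[OF assms]] linearI) auto
  from linear_componentwise_sum[OF this, of w] show ?thesis
    by (simp add: legendre_def inner_vec_def mult.commute)
qed

lemma energy_along_fiber:
  assumes "c \<in> Atl" "(x, y) \<in> slit_domain c"
  shows "((\<lambda>t. energy c (x, y + t *\<^sub>R w)) has_real_derivative legendre c (x, y) \<bullet> w) (at 0)"
  using has_real_derivative_along_line[OF energy_has_derivative[OF assms], of "(0, w)"]
  by (simp add: legendre_inner[OF assms])

lemma legendre_along_fiber:
  assumes "c \<in> Atl" "(x, y) \<in> slit_domain c"
  shows "((\<lambda>t. legendre c (x, y + t *\<^sub>R w)) has_vector_derivative legendre' c (x, y) (0, w)) (at 0)"
  using has_derivative_along_line[OF legendre_has_derivative[OF assms], of "(0, w)"] by simp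

lemma legendre_inner_along_fiber:
  assumes "c \<in> Atl" "(x, y) \<in> slit_domain c"
  shows "((\<lambda>t. legendre c (x, y + t *\<^sub>R w) \<bullet> u) has_real_derivative legendre' c (x, y) (0, w) \<bullet> u) (at 0)"
  using bounded_linear.has_vector_derivative[OF bounded_linear_inner_left legendre_along_fiber[OF assms]]
  by (simp add: has_real_derivative_iff_has_vector_derivative)

lemma eventually_slit_domain:
  assumes "c \<in> Atl" "(x, y) \<in> slit_domain c"
  shows "\<forall>\<^sub>F t in nhds 0. (x, y + t *\<^sub>R w) \<in> slit_domain c"
  using eventually_line[OF open_slit_domain[OF assms(1)] assms(2), of "(0, w)"] by simp

lemma energy_chart:
  assumes "c \<in> Atl" "p \<in> fst c"
  shows "energy c (snd c p, dchart Atl c p v) = (F p v)\<^sup>2 / 2"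
  by (simp add: energy_def tchart_inv_tchart[OF assms])

lemma square_along_fiber:
  assumes "c \<in> Atl" "p \<in> fst c"
  shows "(F p (v + t *\<^sub>R u + s *\<^sub>R w))\<^sup>2
    = 2 * energy c (snd c p, dchart Atl c p v + t *\<^sub>R dchart Atl c p u + s *\<^sub>R dchart Atl c p w)"
  using energy_chart[OF assms, of "v + t *\<^sub>R u + s *\<^sub>R w"] linear_dchart[OF assms]
  by (simp add: linear_add linear_scale)

text \<open>
  The fundamental tensor is the derivative of the Legendre transformation along the fiber. This holds
  in every chart, because the components of tangent vectors change linearly.
\<close>

lemma fund_tensor_chart:
  assumes c: "c \<in> Atl" "p \<in> fst c" and v: "(p, v) \<in> A" "v \<noteq> 0"
  shows "fund_tensor F p v u w =
    legendre' c (snd c p, dchart Atl c p v) (0, dchart Atl c p w) \<bullet> dchart Atl c p u"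
proof -
  let ?x = "snd c p" and ?y = "dchart Atl c p v" and ?u = "dchart Atl c p u" and ?w = "dchart Atl c p w"
  have dom: "(?x, ?y) \<in> slit_domain c" using c v by simp
  have "\<forall>\<^sub>F s in nhds 0. deriv (\<lambda>t. (F p (v + t *\<^sub>R u + s *\<^sub>R w))\<^sup>2) 0
      = 2 * (legendre c (?x, ?y + s *\<^sub>R ?w) \<bullet> ?u)"
    using eventually_slit_domain[OF c(1) dom, of ?w]
  proof (rule eventually_mono)
    fix s assume "(?x, ?y + s *\<^sub>R ?w) \<in> slit_domain c"
    from DERIV_cmult[OF energy_along_fiber[OF c(1) this, of ?u], of 2]
    show "deriv (\<lambda>t. (F p (v + t *\<^sub>R u + s *\<^sub>R w))\<^sup>2) 0
      = 2 * (legendre c (?x, ?y + s *\<^sub>R ?w) \<bullet> ?u)"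
      unfolding square_along_fiber[OF c] by (intro DERIV_imp_deriv) (simp add: add_ac)
  qed
  from deriv_cong_ev[OF this refl]
    DERIV_imp_deriv[OF DERIV_cmult[OF legendre_inner_along_fiber[OF c(1) dom, of ?w ?u], of 2]]
  show ?thesis by (simp add: fund_tensor_def)
qed

lemma legendre'_pos:
  assumes c: "c \<in> Atl" and z: "(x, y) \<in> slit_domain c" and w: "w \<noteq> 0"
  shows "legendre' c (x, y) (0, w) \<bullet> w > 0"
proof -
  obtain p v where p: "(x, y) = (snd c p, dchart Atl c p v)" "p \<in> fst c" "(p, v) \<in> A" "v \<noteq> 0"
    using slit_domainE[OF z] .
  obtain u where u: "dchart Atl c p u = w" using dchart_surj[OF c p(2)] .
  have "fund_tensor F p v u u > 0"
    using conic_metric_axioms(6) p(3,4) w u dchart_eq_0_iff[OF c p(2), of u] by blast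
  then show ?thesis using fund_tensor_chart[OF c p(2-4), of u u] p(1) u by simp
qed


subsection \<open>Homogeneity\<close>

lemma metric_scale: "(p, v) \<in> A \<Longrightarrow> r > 0 \<Longrightarrow> F p (r *\<^sub>R v) = r * F p v"
  using conic_metric_axioms(5) by blast

lemma domain_scale: "(p, v) \<in> A \<Longrightarrow> r > 0 \<Longrightarrow> (p, r *\<^sub>R v) \<in> A"
  using conic_metric_axioms(3) by blast

lemma energy_scale:
  assumes "c \<in> Atl" "(x, y) \<in> slit_domain c" "r > 0"
  shows "(x, r *\<^sub>R y) \<in> slit_domain c" "energy c (x, r *\<^sub>R y) = r\<^sup>2 * energy c (x, y)"
proof -
  obtain p v where p: "(x, y) = (snd c p, dchart Atl c p v)" "p \<in> fst c" "(p, v) \<in> A" "v \<noteq> 0"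
    using slit_domainE[OF assms(2)] .
  have *: "(x, r *\<^sub>R y) = (snd c p, dchart Atl c p (r *\<^sub>R v))"
    using p linear_scale[OF linear_dchart[OF assms(1) p(2)]] by simp
  show "(x, r *\<^sub>R y) \<in> slit_domain c"
    unfolding * using p assms domain_scale by simp
  show "energy c (x, r *\<^sub>R y) = r\<^sup>2 * energy c (x, y)"
    unfolding * unfolding p(1) energy_chart[OF assms(1) p(2)]
    using metric_scale[OF p(3) assms(3)] by (simp add: power_mult_distrib)
qed

lemma euler_energy:
  assumes c: "c \<in> Atl" and z: "(x, y) \<in> slit_domain c"
  shows "legendre c (x, y) \<bullet> y = 2 * energy c (x, y)"
proof -
  have "((\<lambda>t. (1 + t)\<^sup>2 * energy c (x, y)) has_real_derivative 2 * energy c (x, y)) (at 0)"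
    by (auto intro!: derivative_eq_intros)
  moreover have "\<forall>\<^sub>F t in nhds 0. energy c (x, y + t *\<^sub>R y) = (1 + t)\<^sup>2 * energy c (x, y)"
    using eventually_greater_neg[of 1, simplified]
    by (rule eventually_mono) (use energy_scale(2)[OF c z] in \<open>simp add: scaleR_add_left[symmetric, of 1, simplified]\<close>)
  ultimately have "((\<lambda>t. energy c (x, y + t *\<^sub>R y)) has_real_derivative 2 * energy c (x, y)) (at 0)"
    by (rule DERIV_transfer_ev)
  with energy_along_fiber[OF c z, of y] show ?thesis by (rule DERIV_unique)
qed

lemma legendre_scale:
  assumes c: "c \<in> Atl" and z: "(x, y) \<in> slit_domain c" and r: "r > 0"
  shows "legendre c (x, r *\<^sub>R y) = r *\<^sub>R legendre c (x, y)"
proof (rule vector_eq_rdot[THEN iffD1, rule_format])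
  fix w
  note rz = energy_scale(1)[OF c z r]
  have "((\<lambda>t. r\<^sup>2 * energy c (x, y + t *\<^sub>R w)) has_real_derivative r\<^sup>2 * (legendre c (x, y) \<bullet> w)) (at 0)"
    by (rule DERIV_cmult[OF energy_along_fiber[OF c z]])
  moreover have "\<forall>\<^sub>F t in nhds 0. energy c (x, r *\<^sub>R y + t *\<^sub>R (r *\<^sub>R w)) = r\<^sup>2 * energy c (x, y + t *\<^sub>R w)"
    using eventually_slit_domain[OF c z, of w]
  proof (rule eventually_mono)
    fix t assume "(x, y + t *\<^sub>R w) \<in> slit_domain c"
    from energy_scale(2)[OF c this r]
    show "energy c (x, r *\<^sub>R y + t *\<^sub>R (r *\<^sub>R w)) = r\<^sup>2 * energy c (x, y + t *\<^sub>R w)"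
      by (simp add: scaleR_add_right mult.commute)
  qed
  ultimately have "((\<lambda>t. energy c (x, r *\<^sub>R y + t *\<^sub>R (r *\<^sub>R w))) has_real_derivative
      r\<^sup>2 * (legendre c (x, y) \<bullet> w)) (at 0)"
    by (rule DERIV_transfer_ev)
  with energy_along_fiber[OF c rz, of "r *\<^sub>R w"]
  have "legendre c (x, r *\<^sub>R y) \<bullet> (r *\<^sub>R w) = r\<^sup>2 * (legendre c (x, y) \<bullet> w)" by (rule DERIV_unique)
  then show "legendre c (x, r *\<^sub>R y) \<bullet> w = (r *\<^sub>R legendre c (x, y)) \<bullet> w"
    using r by (simp add: power2_eq_square)
qed

lemma legendre'_radial:
  assumes c: "c \<in> Atl" and z: "(x, y) \<in> slit_domain c"
  shows "legendre' c (x, y) (0, y) = legendre c (x, y)"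
proof -
  have "((\<lambda>t. (1 + t) *\<^sub>R legendre c (x, y)) has_vector_derivative legendre c (x, y)) (at 0)"
    by (auto intro!: derivative_eq_intros)
  moreover have "\<forall>\<^sub>F t in nhds 0. (1 + t) *\<^sub>R legendre c (x, y) = legendre c (x, y + t *\<^sub>R y)"
    using eventually_greater_neg[of 1, simplified]
    by (rule eventually_mono) (use legendre_scale[OF c z] in \<open>simp add: scaleR_add_left[symmetric, of 1, simplified]\<close>)
  ultimately have "((\<lambda>t. legendre c (x, y + t *\<^sub>R y)) has_vector_derivative legendre c (x, y)) (at 0)"
    by (rule has_vector_derivative_transfer_ev)
  with legendre_along_fiber[OF c z, of y] show ?thesis by (rule vector_derivative_unique_at)
qed

text \<open>
  Differentiating Euler's relation along the fiber. Together with the previous lemma it identifies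
  both \<open>g\<^sub>v(v, _)\<close> and \<open>g\<^sub>v(_, v)\<close> with the Legendre transform of \<open>v\<close>.
\<close>

lemma legendre'_inner_radial:
  assumes c: "c \<in> Atl" and z: "(x, y) \<in> slit_domain c"
  shows "legendre' c (x, y) (0, w) \<bullet> y = legendre c (x, y) \<bullet> w"
proof -
  let ?L = "legendre c (x, y)" and ?L' = "legendre' c (x, y) (0, w)"
  have "((\<lambda>t. y + t *\<^sub>R w) has_vector_derivative w) (at 0)"
    by (auto intro!: derivative_eq_intros)
  from bounded_bilinear.has_vector_derivative[OF bounded_bilinear_inner legendre_along_fiber[OF c z, of w] this]
  have "((\<lambda>t. legendre c (x, y + t *\<^sub>R w) \<bullet> (y + t *\<^sub>R w)) has_real_derivative ?L \<bullet> w + ?L' \<bullet> y) (at 0)"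
    by (simp add: has_real_derivative_iff_has_vector_derivative)
  moreover have "\<forall>\<^sub>F t in nhds 0. 2 * energy c (x, y + t *\<^sub>R w) = legendre c (x, y + t *\<^sub>R w) \<bullet> (y + t *\<^sub>R w)"
    using eventually_slit_domain[OF c z, of w] by (rule eventually_mono) (rule euler_energy[OF c, symmetric])
  ultimately have "((\<lambda>t. 2 * energy c (x, y + t *\<^sub>R w)) has_real_derivative ?L \<bullet> w + ?L' \<bullet> y) (at 0)"
    by (rule DERIV_transfer_ev)
  with DERIV_cmult[OF energy_along_fiber[OF c z, of w], of 2]
  have "2 * (?L \<bullet> w) = ?L \<bullet> w + ?L' \<bullet> y" by (rule DERIV_unique)
  then show ?thesis by simp
qed

lemma fund_tensor_radial:
  assumes c: "c \<in> Atl" "p \<in> fst c" and v: "(p, v) \<in> A" "v \<noteq> 0"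
  shows "fund_tensor F p v v w = legendre c (snd c p, dchart Atl c p v) \<bullet> dchart Atl c p w"
    and "fund_tensor F p v w v = legendre c (snd c p, dchart Atl c p v) \<bullet> dchart Atl c p w"
  using fund_tensor_chart[OF c v] legendre'_inner_radial[OF c(1)] legendre'_radial[OF c(1)] c v
  by simp_all

lemma fund_tensor_radial_sym:
  assumes "(p, v) \<in> A" "v \<noteq> 0" shows "fund_tensor F p v w v = fund_tensor F p v v w"
  using fund_tensor_radial[OF chart_at assms] by simp

lemma linear_fund_tensor_radial:
  assumes "(p, v) \<in> A" "v \<noteq> 0" shows "linear (fund_tensor F p v v)"
  using fund_tensor_radial(1)[OF chart_at assms] by (intro linearI) (simp_all add: inner_add_right)

lemma fund_tensor_scale_base:
  assumes "(p, v) \<in> A" "v \<noteq> 0" "r > 0"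
  shows "fund_tensor F p (r *\<^sub>R v) (r *\<^sub>R v) w = r * fund_tensor F p v v w"
  using fund_tensor_radial(1)[OF chart_at assms(1,2), of w]
    fund_tensor_radial(1)[OF chart_at domain_scale[OF assms(1,3)], of w]
    legendre_scale[OF chart_at(1)[of p] _ assms(3), of "snd (chart_at Atl p) p" v] assms
  by simp

lemma fund_tensor_scale_args:
  assumes "(p, v) \<in> A" "v \<noteq> 0"
  shows "fund_tensor F p v (r *\<^sub>R u) (s *\<^sub>R w) = r * s * fund_tensor F p v u w"
proof -
  let ?c = "chart_at Atl p"
  have "(snd ?c p, v) \<in> slit_domain ?c" using assms by simp
  from linear_scale[OF has_derivative_linear[OF legendre_has_derivative[OF chart_at(1) this]], of s "(0, w)"]
  show ?thesis using fund_tensor_chart[OF chart_at assms] by simp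
qed

lemma fund_tensor_self:
  assumes v: "(p, v) \<in> A" "v \<noteq> 0" shows "fund_tensor F p v v v = (F p v)\<^sup>2"
  using fund_tensor_radial(1)[OF chart_at v, of v] energy_chart[OF chart_at, of p v]
    euler_energy[OF chart_at(1)[of p], of "snd (chart_at Atl p) p" v] v by simp

lemma metric_pos:
  assumes v: "(p, v) \<in> A" "v \<noteq> 0" shows "F p v > 0"
proof -
  have "fund_tensor F p v v v > 0" "F p v \<ge> 0"
    using conic_metric_axioms(4,6) v by blast+
  then show ?thesis using fund_tensor_self[OF v] by (cases "F p v = 0") auto
qed

text \<open>
  The fiber derivative of \<open>F\<^sup>2\<close> is homogeneous of degree one, so differentiating it twice more
  along the ray of the base point gives zero.
\<close>

lemma cartan_tensor_radial:
  assumes v: "(p, v) \<in> A" "v \<noteq> 0" shows "cartan_tensor F p v u v v = 0"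
proof -
  define c where "c = chart_at Atl p"
  have c: "c \<in> Atl" "p \<in> fst c" unfolding c_def by (rule chart_at)+
  let ?x = "snd c p" and ?y = "dchart Atl c p v" and ?u = "dchart Atl c p u"
  have dom: "(?x, ?y) \<in> slit_domain c" using c v by simp
  \<comment> \<open>As long as the parameters sum to more than \<open>-1\<close>, the base point stays on the ray of \<open>v\<close>; below, each of them exceeds \<open>-1/2\<close>.\<close>
  have 1: "deriv (\<lambda>t. (F p (v + t *\<^sub>R u + s *\<^sub>R v + r *\<^sub>R v))\<^sup>2) 0 = (1 + s + r) * (2 * (legendre c (?x, ?y) \<bullet> ?u))"
    if "s + r > - 1" for s r
  proof -
    have pos: "1 + s + r > 0" using that by simp
    have eq: "(F p (v + t *\<^sub>R u + s *\<^sub>R v + r *\<^sub>R v))\<^sup>2 = 2 * energy c (?x, (1 + s + r) *\<^sub>R ?y + t *\<^sub>R ?u)" for t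
      using energy_chart[OF c, of "v + t *\<^sub>R u + s *\<^sub>R v + r *\<^sub>R v"] linear_dchart[OF c]
      by (simp add: linear_add linear_scale scaleR_add_left add_ac)
    show ?thesis unfolding eq
      using DERIV_imp_deriv[OF DERIV_cmult[OF energy_along_fiber[OF c(1) energy_scale(1)[OF c(1) dom pos], of ?u], of 2]]
      by (simp add: legendre_scale[OF c(1) dom pos])
  qed
  have 2: "deriv (\<lambda>s. deriv (\<lambda>t. (F p (v + t *\<^sub>R u + s *\<^sub>R v + r *\<^sub>R v))\<^sup>2) 0) 0 = 2 * (legendre c (?x, ?y) \<bullet> ?u)"
    if "r > - (1/2)" for r
  proof -
    have ev: "\<forall>\<^sub>F s in nhds 0. deriv (\<lambda>t. (F p (v + t *\<^sub>R u + s *\<^sub>R v + r *\<^sub>R v))\<^sup>2) 0 = (1 + s + r) * (2 * (legendre c (?x, ?y) \<bullet> ?u))"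
      using eventually_greater_neg[of "1/2", simplified]
      by (rule eventually_mono) (rule 1, use that in simp)
    have "((\<lambda>s. (1 + s + r) * k) has_real_derivative k) (at 0)" for k
      by (auto intro!: derivative_eq_intros)
    from trans[OF deriv_cong_ev[OF ev refl] DERIV_imp_deriv[OF this]] show ?thesis .
  qed
  have "\<forall>\<^sub>F r in nhds 0. deriv (\<lambda>s. deriv (\<lambda>t. (F p (v + t *\<^sub>R u + s *\<^sub>R v + r *\<^sub>R v))\<^sup>2) 0) 0 = 2 * (legendre c (?x, ?y) \<bullet> ?u)"
    using eventually_greater_neg[of "1/2", simplified] by (rule eventually_mono) (rule 2)
  from deriv_cong_ev[OF this refl] show ?thesis by (simp add: cartan_tensor_def)
qed

end


section \<open>The gradient of a smooth function\<close>

context smooth_manifold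
begin

definition grad_rep :: "('m \<Rightarrow> real) \<Rightarrow> ('m, 'n) chart \<Rightarrow> real^'n \<Rightarrow> real^'n" where
  "grad_rep f c x = (\<chi> i. frechet_derivative (f \<circ> cinv c) (at x) (axis i 1))"

lemma smooth_grad_rep:
  assumes "open U" "smooth_fun_on Atl U f" "c \<in> Atl"
  shows "smooth_on (grad_rep f c) (snd c ` (U \<inter> fst c))"
proof -
  have "smooth_on (f \<circ> cinv c) (snd c ` (U \<inter> fst c))"
    by (rule bspec[OF assms(2)[unfolded smooth_fun_on_def] assms(3)])
  from smooth_on_frechet_derivative[OF this, unfolded smooth_on_def, THEN spec]
  show ?thesis
    unfolding smooth_on_def grad_rep_def[abs_def]
    by (intro allI, rule_tac Ck_on_vec[OF open_chart_image[OF assms(3,1)]])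
qed

lemma grad_rep_inner:
  assumes "smooth_fun_on Atl U f" "c \<in> Atl" "p \<in> U" "p \<in> fst c"
  shows "grad_rep f c (snd c p) \<bullet> dchart Atl c p u = differential Atl f p u"
proof -
  note d = smooth_fun_has_derivative[OF assms]
  have "differential Atl f p u = frechet_derivative (f \<circ> cinv c) (at (snd c p)) (dchart Atl c p u)"
    by (rule differential_chart[OF assms(2,4) differentiableI[OF d]])
  with linear_componentwise_sum[OF has_derivative_linear[OF d], of "dchart Atl c p u"]
  show ?thesis by (simp add: grad_rep_def inner_vec_def mult.commute)
qed

lemma differential_has_derivative:
  assumes "differentiable_at Atl h p"
  shows "(h \<circ> cinv (chart_at Atl p) has_derivative differential Atl h p) (at (snd (chart_at Atl p) p))"
  using assms unfolding differentiable_at_def differential_def by (simp add: frechet_derivative_works)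

lemma linear_differential: "differentiable_at Atl h p \<Longrightarrow> linear (differential Atl h p)"
  by (rule has_derivative_linear[OF differential_has_derivative])

lemma differential_unique:
  assumes "(h \<circ> cinv (chart_at Atl p) has_derivative D) (at (snd (chart_at Atl p) p))"
    and "open V" "p \<in> V" "\<And>q. q \<in> V \<Longrightarrow> g q = h q"
  shows "differential Atl g p = D"
proof -
  have "(g \<circ> cinv (chart_at Atl p) has_derivative D) (at (snd (chart_at Atl p) p))"
    by (rule has_derivative_transform_within_open[OF assms(1) open_chart_image[OF chart_at(1) assms(2)]])
       (use assms(3,4) chart_at in auto)
  from frechet_derivative_at[OF this] show ?thesis unfolding differential_def by simp
qed

end

context conic_metric
begin

lemma is_gradient_iff:
  assumes f: "smooth_fun_on Atl U f" and p: "c \<in> Atl" "p \<in> U" "p \<in> fst c"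
  shows "is_gradient Atl A F f p v \<longleftrightarrow> (snd c p, dchart Atl c p v) \<in> slit_domain c \<and>
     legendre c (snd c p, dchart Atl c p v) = grad_rep f c (snd c p)"
proof -
  have "(\<forall>u. fund_tensor F p v v u = differential Atl f p u) \<longleftrightarrow>
     legendre c (snd c p, dchart Atl c p v) = grad_rep f c (snd c p)" (is "?l \<longleftrightarrow> ?r")
    if v: "(p, v) \<in> A" "v \<noteq> 0"
  proof
    assume l: ?l
    have "legendre c (snd c p, dchart Atl c p v) \<bullet> w = grad_rep f c (snd c p) \<bullet> w" for w
    proof -
      obtain u where u: "dchart Atl c p u = w" using dchart_surj[OF p(1,3)] .
      show ?thesis
        using l[rule_format, of u] fund_tensor_radial(1)[OF p(1,3) v, of u] grad_rep_inner[OF f p, of u]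
        unfolding u by linarith
    qed
    then show ?r by (rule vector_eq_rdot[THEN iffD1, rule_format])
  next
    assume ?r
    then show ?l using fund_tensor_radial(1)[OF p(1,3) v] grad_rep_inner[OF f p] by simp
  qed
  then show ?thesis unfolding is_gradient_def using p by auto
qed

lemma is_gradient_differential:
  assumes "is_gradient Atl A F f p v" shows "differential Atl f p v = (F p v)\<^sup>2" "F p v > 0"
proof -
  have v: "(p, v) \<in> A" "v \<noteq> 0" and "fund_tensor F p v v v = differential Atl f p v"
    using assms unfolding is_gradient_def by simp_all
  then show "differential Atl f p v = (F p v)\<^sup>2" using fund_tensor_self by simp
  show "F p v > 0" using metric_pos[OF v] .
qed

lemma regular_admissible_iff:
  assumes f: "smooth_fun_on Atl U f"
  shows "p \<in> regular_admissible Atl A F U f \<longleftrightarrow> p \<in> U \<and> (\<exists>v. is_gradient Atl A F f p v)"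
proof -
  have "differential Atl f p \<noteq> (\<lambda>u. 0)" if "is_gradient Atl A F f p v" for v
    using is_gradient_differential[OF that] by auto
  moreover have "differentiable_at Atl f p" if "p \<in> U"
    unfolding differentiable_at_def
    by (rule differentiableI[OF smooth_fun_has_derivative[OF f chart_at(1) that chart_at(2)]])
  ultimately show ?thesis unfolding regular_admissible_def by blast
qed

end

text \<open>
  Metrics whose Legendre transformation is injective on every fiber. The fibers of the domain of a
  conic metric need not be convex, so local convexity of the energy does not give this property in
  general. Injectivity makes gradients unique, and it makes the set of points at which a gradient
  exists open.
\<close>

locale legendre_metric = conic_metric Atl A F
  for Atl :: "('m::{t2_space, second_countable_topology}, 'n::finite) chart set"
    and A :: "('m \<times> (real^'n)) set" and F :: "'m \<Rightarrow> real^'n \<Rightarrow> real" +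
  assumes legendre_inj: "\<And>p v w. (p, v) \<in> A \<Longrightarrow> v \<noteq> 0 \<Longrightarrow> (p, w) \<in> A \<Longrightarrow> w \<noteq> 0 \<Longrightarrow>
    (\<And>u. fund_tensor F p v v u = fund_tensor F p w w u) \<Longrightarrow> v = w"
begin

lemma gradient_eq:
  assumes "is_gradient Atl A F f p v" shows "gradient Atl A F f p = v"
proof -
  have "w = v" if w: "is_gradient Atl A F f p w" for w
    using assms w legendre_inj unfolding is_gradient_def by metis
  then have "(THE v. is_gradient Atl A F f p v) = v" using assms by (rule the_equality[rotated])
  moreover have "differential Atl f p \<noteq> (\<lambda>u. 0)"
    using is_gradient_differential[OF assms] by auto
  ultimately show ?thesis unfolding gradient_def by simp
qed

lemma is_gradient_gradient:
  assumes "p \<in> regular_admissible Atl A F U f"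
  shows "is_gradient Atl A F f p (gradient Atl A F f p)"
proof -
  obtain v where "is_gradient Atl A F f p v"
    using assms unfolding regular_admissible_def by blast
  with gradient_eq[OF this] show ?thesis by simp
qed

text \<open>
  Keeping the base point next to the Legendre transform gives an injective map from an open set
  into a space of the same dimension. Invariance of domain makes its image open, and the gradient of
  \<open>f\<close> is read off from its inverse along the section \<open>x \<mapsto> (x, df\<^sub>x)\<close>.
\<close>

definition legendre_pair where "legendre_pair c z = (fst z, legendre c z)"

lemma legendre_pair_inj:
  assumes c: "c \<in> Atl" shows "inj_on (legendre_pair c) (slit_domain c)"
proof (rule inj_onI)
  fix z z' assume "z \<in> slit_domain c" "z' \<in> slit_domain c" and eq: "legendre_pair c z = legendre_pair c z'"
  then obtain p v p' v' where p: "z = (snd c p, dchart Atl c p v)" "p \<in> fst c" "(p, v) \<in> A" "v \<noteq> 0"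
    and p': "z' = (snd c p', dchart Atl c p' v')" "p' \<in> fst c" "(p', v') \<in> A" "v' \<noteq> 0"
    by (elim slit_domainE)
  from eq have "snd c p = snd c p'" using p(1) p'(1) by (simp add: legendre_pair_def)
  then have pp: "p' = p" using c p(2) p'(2) cinv_chart by metis
  note p' = p'[unfolded pp]
  have L: "legendre c (snd c p, dchart Atl c p v) = legendre c (snd c p, dchart Atl c p v')"
    using eq p(1) p'(1) by (simp add: legendre_pair_def)
  have "v = v'"
    by (rule legendre_inj[OF p(3,4) p'(3,4)])
       (simp only: fund_tensor_radial(1)[OF c p(2-4)] fund_tensor_radial(1)[OF c p'(2-4)] L)
  then show "z = z'" using p(1) p'(1) by simp
qed

lemma legendre_pair_has_derivative:
  assumes c: "c \<in> Atl" and z: "z \<in> slit_domain c"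
  shows "(legendre_pair c has_derivative (\<lambda>d. (fst d, legendre' c z d))) (at z)"
  unfolding legendre_pair_def[abs_def]
  by (intro has_derivative_Pair has_derivative_fst has_derivative_ident legendre_has_derivative[OF c z])

lemma legendre'_nondegenerate:
  assumes "c \<in> Atl" "z \<in> slit_domain c" "legendre' c z (0, w) = 0" shows "w = 0"
proof (rule ccontr)
  assume "w \<noteq> 0"
  obtain x y where "z = (x, y)" by (rule prod.exhaust)
  with legendre'_pos[OF assms(1) _ \<open>w \<noteq> 0\<close>, of x y] assms(2,3) show False by simp
qed

lemma continuous_on_legendre_pair: "c \<in> Atl \<Longrightarrow> continuous_on (slit_domain c) (legendre_pair c)"
  by (intro continuous_at_imp_continuous_on ballI)
     (erule (1) has_derivative_continuous[OF legendre_pair_has_derivative])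

lemma legendre_pair_inverse_differentiable:
  assumes c: "c \<in> Atl" and z: "z \<in> slit_domain c"
  shows "inv_into (slit_domain c) (legendre_pair c) differentiable (at (legendre_pair c z))"
proof -
  let ?D = "\<lambda>d. (fst d, legendre' c z d)"
  note der = legendre_pair_has_derivative[OF c z]
  have lin: "linear ?D" by (rule has_derivative_linear[OF der])
  have "d = 0" if "?D d = 0" for d
  proof -
    obtain a b where d: "d = (a, b)" by (rule prod.exhaust)
    with that have "a = 0" by (simp add: zero_prod_def)
    moreover from this that d have "legendre' c z (0, b) = 0" by (simp add: zero_prod_def)
    ultimately show ?thesis using legendre'_nondegenerate[OF c z, of b] d by (simp add: zero_prod_def)
  qed
  then have "inj ?D" using linear_injective_0[OF lin] by blast
  then obtain D' where D': "\<And>d. ?D (D' d) = d"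
    using linear_injective_isomorphism[OF lin] by blast
  show ?thesis
  proof (rule differentiableI, rule has_derivative_inverse_strong[OF open_slit_domain[OF c] z continuous_on_legendre_pair[OF c] _ der])
    show "inv_into (slit_domain c) (legendre_pair c) (legendre_pair c z') = z'" if "z' \<in> slit_domain c" for z'
      by (rule inv_into_f_f[OF legendre_pair_inj[OF c] that])
    show "?D \<circ> D' = id" using D' by (simp only: fun_eq_iff o_def id_def) simp
  qed
qed

context
  fixes U :: "'m set" and f :: "'m \<Rightarrow> real"
  assumes U: "open U" and f: "smooth_fun_on Atl U f"
begin

abbreviation "Reg \<equiv> regular_admissible Atl A F U f"
abbreviation "Grad \<equiv> gradient Atl A F f"

lemma regular_image:
  assumes c: "c \<in> Atl"
  shows "snd c ` (Reg \<inter> fst c) =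
    snd c ` (U \<inter> fst c) \<inter> (\<lambda>x. (x, grad_rep f c x)) -` (legendre_pair c ` slit_domain c)" (is "?l = ?r")
proof (intro set_eqI iffI)
  fix x assume "x \<in> ?l"
  then obtain p where p: "x = snd c p" "p \<in> Reg" "p \<in> fst c" by blast
  have pU: "p \<in> U" using p(2) by (simp add: regular_admissible_def)
  from is_gradient_gradient[OF p(2)]
  have "(x, dchart Atl c p (Grad p)) \<in> slit_domain c" "legendre_pair c (x, dchart Atl c p (Grad p)) = (x, grad_rep f c x)"
    unfolding is_gradient_iff[OF f c pU p(3)] legendre_pair_def p(1) by simp_all
  then have "(x, grad_rep f c x) \<in> legendre_pair c ` slit_domain c" by (metis imageI)
  with p pU show "x \<in> ?r" by simp
next
  fix x assume x: "x \<in> ?r"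
  then obtain p where p: "x = snd c p" "p \<in> U" "p \<in> fst c" by blast
  from x obtain z where z: "z \<in> slit_domain c" "legendre_pair c z = (x, grad_rep f c x)" by (metis IntD2 imageE vimageE)
  from z(1) obtain q v where q: "z = (snd c q, dchart Atl c q v)" "q \<in> fst c" "(q, v) \<in> A" "v \<noteq> 0"
    by (rule slit_domainE)
  from z(2) q(1) p(1) have "snd c q = snd c p" by (simp add: legendre_pair_def)
  then have "q = p" using c p(3) q(2) cinv_chart by metis
  with z q p have "is_gradient Atl A F f p v"
    unfolding is_gradient_iff[OF f c p(2,3)] legendre_pair_def by simp
  then have "p \<in> Reg" using regular_admissible_iff[OF f] p(2) by blast
  with p show "x \<in> ?l" by blast
qed

lemma open_regular_image:
  assumes c: "c \<in> Atl" shows "open (snd c ` (Reg \<inter> fst c))"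
  unfolding regular_image[OF c]
proof (rule continuous_open_preimage)
  show "open (snd c ` (U \<inter> fst c))" by (rule open_chart_image[OF c U])
  have "continuous_on (snd c ` (U \<inter> fst c)) (grad_rep f c)"
    by (rule Ck_on_imp_continuous_on[of 0], rule spec[OF smooth_grad_rep[OF U f c, unfolded smooth_on_def]])
  then show "continuous_on (snd c ` (U \<inter> fst c)) (\<lambda>x. (x, grad_rep f c x))"
    by (intro continuous_on_Pair continuous_on_id)
  show "open (legendre_pair c ` slit_domain c)"
    by (rule invariance_of_domain[OF continuous_on_legendre_pair open_slit_domain legendre_pair_inj]) (rule c)+
qed

lemma open_regular: "open Reg"
  unfolding open_subopen[of Reg]
proof
  fix p assume p: "p \<in> Reg"
  let ?c = "chart_at Atl p"
  let ?T = "fst ?c \<inter> snd ?c -` (snd ?c ` (Reg \<inter> fst ?c))"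
  have "open ?T"
    by (rule continuous_open_preimage[OF continuous_on_chart[OF chart_at(1)] open_chart(1)[OF chart_at(1)]
        open_regular_image[OF chart_at(1)]])
  moreover have "p \<in> ?T" using p chart_at by blast
  moreover have "?T \<subseteq> Reg"
  proof
    fix q assume "q \<in> ?T"
    then obtain q' where "q \<in> fst ?c" "q' \<in> Reg" "q' \<in> fst ?c" "snd ?c q = snd ?c q'" by blast
    then show "q \<in> Reg" using cinv_chart[OF chart_at(1)] by metis
  qed
  ultimately show "\<exists>T. open T \<and> p \<in> T \<and> T \<subseteq> Reg" by blast
qed

lemma gradient_chart:
  assumes c: "c \<in> Atl" and x: "x \<in> snd c ` (Reg \<inter> fst c)"
  shows "(x, vf_rep Atl c Grad x) \<in> slit_domain c" "legendre c (x, vf_rep Atl c Grad x) = grad_rep f c x"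
    and "vf_rep Atl c Grad x = snd (inv_into (slit_domain c) (legendre_pair c) (x, grad_rep f c x))"
proof -
  obtain p where p: "x = snd c p" "p \<in> Reg" "p \<in> fst c" using x by blast
  have pU: "p \<in> U" using p(2) by (simp add: regular_admissible_def)
  from is_gradient_gradient[OF p(2)]
  show *: "(x, vf_rep Atl c Grad x) \<in> slit_domain c" "legendre c (x, vf_rep Atl c Grad x) = grad_rep f c x"
    unfolding is_gradient_iff[OF f c pU p(3)] by (simp_all only: p(1) vf_rep_chart[OF c p(3)])
  from inv_into_f_f[OF legendre_pair_inj[OF c] *(1)]
  show "vf_rep Atl c Grad x = snd (inv_into (slit_domain c) (legendre_pair c) (x, grad_rep f c x))"
    unfolding legendre_pair_def fst_conv *(2) by (simp only: snd_conv)
qed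

lemma gradient_differentiable:
  assumes c: "c \<in> Atl" and x: "x \<in> snd c ` (Reg \<inter> fst c)"
  shows "vf_rep Atl c Grad differentiable (at x)"
proof -
  let ?g = "inv_into (slit_domain c) (legendre_pair c)"
  have "x \<in> snd c ` (U \<inter> fst c)" using x unfolding regular_image[OF c] by blast
  note grad = smooth_on_has_derivative[OF smooth_grad_rep[OF U f c] this]
  have "legendre_pair c (x, vf_rep Atl c Grad x) = (x, grad_rep f c x)"
    using gradient_chart(2)[OF c x] by (simp add: legendre_pair_def)
  with legendre_pair_inverse_differentiable[OF c gradient_chart(1)[OF c x]]
  obtain D where "(?g has_derivative D) (at (x, grad_rep f c x))"
    unfolding differentiable_def by auto
  from has_derivative_compose[OF has_derivative_Pair[OF has_derivative_ident grad] this]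
  have "((\<lambda>x. snd (?g (x, grad_rep f c x))) has_derivative
     (\<lambda>d. snd (D (d, frechet_derivative (grad_rep f c) (at x) d)))) (at x)"
    by (rule has_derivative_snd)
  then have "(vf_rep Atl c Grad has_derivative
     (\<lambda>d. snd (D (d, frechet_derivative (grad_rep f c) (at x) d)))) (at x)"
    by (rule has_derivative_transform_within_open[OF _ open_regular_image[OF c] x])
       (rule gradient_chart(3)[OF c, symmetric])
  then show ?thesis by (rule differentiableI)
qed

lemma smooth_gradient: "smooth_vf_on Atl Reg Grad"
  unfolding smooth_vf_on_def
proof
  fix c assume c: "c \<in> Atl"
  show "smooth_on (vf_rep Atl c Grad) (snd c ` (Reg \<inter> fst c))"
  proof (rule smooth_on_implicit[where \<phi> = "grad_rep f c", OF open_regular_image[OF c] open_slit_domain[OF c] smooth_legendre[OF c]])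
    show "smooth_on (grad_rep f c) (snd c ` (Reg \<inter> fst c))"
      using smooth_grad_rep[OF U f c] Ck_on_subset unfolding smooth_on_def regular_image[OF c] by blast
    show "w = 0" if "x \<in> snd c ` (Reg \<inter> fst c)" "legendre' c (x, vf_rep Atl c Grad x) (0, w) = 0" for x w
      by (rule legendre'_nondegenerate[OF c gradient_chart(1)[OF c that(1)] that(2)])
  qed (fact gradient_differentiable[OF c] gradient_chart(1,2)[OF c])+
qed


section \<open>The divergence of the normalized gradient\<close>

definition gradient_length :: "'m \<Rightarrow> real" where "gradient_length q = F q (Grad q)"

lemma gradient_admissible: "p \<in> Reg \<Longrightarrow> (p, Grad p) \<in> A" "p \<in> Reg \<Longrightarrow> Grad p \<noteq> 0"
  using is_gradient_gradient unfolding is_gradient_def by blast+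

lemma gradient_length_pos: "p \<in> Reg \<Longrightarrow> gradient_length p > 0"
  using is_gradient_differential(2)[OF is_gradient_gradient] unfolding gradient_length_def by blast

lemma gradient_length_differentiable:
  assumes p: "p \<in> Reg" shows "differentiable_at Atl gradient_length p"
proof -
  let ?c = "chart_at Atl p"
  let ?x = "snd ?c p" and ?F = "case_prod F \<circ> tchart_inv Atl ?c"
  note c = chart_at[of p]
  have x: "?x \<in> snd ?c ` (Reg \<inter> fst ?c)" using p c by blast
  have "(vf_rep Atl ?c Grad has_derivative frechet_derivative (vf_rep Atl ?c Grad) (at ?x)) (at ?x)"
    using gradient_differentiable[OF c(1) x] by (simp only: frechet_derivative_works)
  note pair = has_derivative_Pair[OF has_derivative_ident this]
  note chain = has_derivative_compose[OF pair smooth_on_has_derivative[OF smooth_metric_chart[OF c(1)] gradient_chart(1)[OF c(1) x]]]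
  have "?F (y, vf_rep Atl ?c Grad y) = (gradient_length \<circ> cinv ?c) y" if y: "y \<in> snd ?c ` (Reg \<inter> fst ?c)" for y
  proof -
    obtain q where q: "y = snd ?c q" "q \<in> fst ?c" using y by blast
    show ?thesis using c q by (simp add: vf_rep_chart tchart_inv_tchart gradient_length_def)
  qed
  from has_derivative_transform_within_open[OF chain open_regular_image[OF c(1)] x this]
  show ?thesis unfolding differentiable_at_def by (rule differentiableI)
qed

text \<open>
  With all three fields equal to the gradient, the Cartan term of the almost metric condition
  vanishes, and the condition says that the Hessian in the direction of the gradient measures the
  change of its length.
\<close>

lemma hessian_gradient:
  assumes D: "chern_connection Atl A F D" and p: "p \<in> Reg"
  shows "hessian Atl A F D U f p (Grad p /\<^sub>R gradient_length p) (Grad p /\<^sub>R gradient_length p) =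
    differential Atl gradient_length p (Grad p) / gradient_length p"
proof -
  have "admissible_on A Reg Grad" using gradient_admissible unfolding admissible_on_def by blast
  with D open_regular smooth_gradient
  have aff: "affine_connection_on Atl Reg (D Reg Grad)" and met: "almost_metric_on Atl F Reg Grad (D Reg Grad)"
    unfolding chern_connection_def by blast+
  have lin: "linear (\<lambda>u. D Reg Grad p u Grad)"
    using aff smooth_gradient p unfolding affine_connection_on_def by blast
  let ?X = "D Reg Grad p (Grad p) Grad"
  note v = gradient_admissible[OF p]
  have "differential Atl (\<lambda>q. fund_tensor F q (Grad q) (Grad q) (Grad q)) p (Grad p) =
      fund_tensor F p (Grad p) ?X (Grad p) + fund_tensor F p (Grad p) (Grad p) ?X + 2 * cartan_tensor F p (Grad p) ?X (Grad p) (Grad p)"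
    using met smooth_gradient p unfolding almost_metric_on_def by blast
  also have "\<dots> = 2 * fund_tensor F p (Grad p) ?X (Grad p)"
    using cartan_tensor_radial[OF v] fund_tensor_radial_sym[OF v] by simp
  also have "differential Atl (\<lambda>q. fund_tensor F q (Grad q) (Grad q) (Grad q)) p = (\<lambda>u. 2 * gradient_length p * differential Atl gradient_length p u)"
  proof (rule differential_unique[OF _ open_regular p])
    show "fund_tensor F q (Grad q) (Grad q) (Grad q) = gradient_length q * gradient_length q" if "q \<in> Reg" for q
      using fund_tensor_self[OF gradient_admissible[OF that]] by (simp add: gradient_length_def power2_eq_square)
    from has_derivative_mult[OF differential_has_derivative differential_has_derivative, OF gradient_length_differentiable gradient_length_differentiable, OF p p]
    show "((\<lambda>q. gradient_length q * gradient_length q) \<circ> cinv (chart_at Atl p) has_derivative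
       (\<lambda>u. 2 * gradient_length p * differential Atl gradient_length p u)) (at (snd (chart_at Atl p) p))"
      using chart_at[of p] by (simp add: o_def mult.assoc)
  qed
  finally have *: "fund_tensor F p (Grad p) ?X (Grad p) = gradient_length p * differential Atl gradient_length p (Grad p)" by simp
  have "hessian Atl A F D U f p (Grad p /\<^sub>R gradient_length p) (Grad p /\<^sub>R gradient_length p) =
      inverse (gradient_length p) * inverse (gradient_length p) * fund_tensor F p (Grad p) ?X (Grad p)"
    by (simp add: hessian_def Let_def linear_scale[OF lin] fund_tensor_scale_args[OF v])
  with * gradient_length_pos[OF p] show ?thesis by (simp add: field_simps)
qed

lemma normalized_gradient_differentiable:
  assumes p: "p \<in> Reg"
  shows "vf_rep Atl (chart_at Atl p) (\<lambda>q. Grad q /\<^sub>R gradient_length q) differentiable (at (snd (chart_at Atl p) p))"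
proof -
  let ?c = "chart_at Atl p"
  let ?x = "snd ?c p"
  note c = chart_at[of p]
  have x: "?x \<in> snd ?c ` (Reg \<inter> fst ?c)" using p c by blast
  have s: "(gradient_length \<circ> cinv ?c) differentiable (at ?x)"
    using gradient_length_differentiable[OF p] unfolding differentiable_at_def .
  have "(\<lambda>y. inverse ((gradient_length \<circ> cinv ?c) y) *\<^sub>R vf_rep Atl ?c Grad y) differentiable (at ?x)"
    by (intro differentiable_scaleR differentiable_inverse s gradient_differentiable[OF c(1) x])
       (use gradient_length_pos[OF p] c in simp)
  then show ?thesis
    by (rule differentiable_vf_rep[OF c, rotated]) (simp add: linear_scale[OF linear_dchart] vf_rep_chart c)
qed

text \<open>
  Subtracting the Hessian in the direction of the gradient removes from the Laplacian the change of
  the length of the gradient.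
\<close>

lemma divergence_normalized_gradient:
  assumes D: "chern_connection Atl A F D" and \<nu>: "volume_form Atl \<nu>" and p: "p \<in> Reg"
  shows "1 / gradient_length p * (laplacian Atl A F \<nu> f p
      - hessian Atl A F D U f p (Grad p /\<^sub>R gradient_length p) (Grad p /\<^sub>R gradient_length p)) =
    divergence Atl \<nu> (\<lambda>q. Grad q /\<^sub>R gradient_length q) p"
proof -
  let ?c = "chart_at Atl p" and ?n = "\<lambda>q. Grad q /\<^sub>R gradient_length q"
  note n = normalized_gradient_differentiable[OF p] and s = gradient_length_differentiable[OF p]
  have "((\<lambda>y. (gradient_length \<circ> cinv ?c) y *\<^sub>R vf_rep Atl ?c ?n y) differentiable (at (snd ?c p)))"
    by (intro differentiable_scaleR n) (use s in \<open>unfold differentiable_at_def\<close>)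
  then have diff: "vf_rep Atl ?c (\<lambda>q. gradient_length q *\<^sub>R ?n q) differentiable (at (snd ?c p))"
    by (rule differentiable_vf_rep[OF chart_at, rotated])
       (simp add: linear_scale[OF linear_dchart] vf_rep_chart chart_at)
  have "laplacian Atl A F \<nu> f p = divergence Atl \<nu> (\<lambda>q. gradient_length q *\<^sub>R ?n q) p"
    unfolding laplacian_def
    by (rule divergence_cong[OF \<nu> open_regular p _ diff]) (use gradient_length_pos in fastforce)
  also have "\<dots> = gradient_length p * divergence Atl \<nu> ?n p + differential Atl gradient_length p (?n p)"
    by (rule divergence_scaleR[OF \<nu> n s])
  also have "differential Atl gradient_length p (?n p) = differential Atl gradient_length p (Grad p) / gradient_length p"
    by (simp add: linear_scale[OF linear_differential[OF s]] divide_inverse mult.commute)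
  finally show ?thesis
    using hessian_gradient[OF assms(1) p] gradient_length_pos[OF p] by simp
qed

text \<open>A gradient of constant length has no length change for the Hessian to measure.\<close>

lemma hessian_unit_length:
  assumes D: "chern_connection Atl A F D" and p: "p \<in> Reg"
    and V: "open V" "p \<in> V" "\<And>q. q \<in> V \<Longrightarrow> gradient_length q = 1"
  shows "hessian Atl A F D U f p (Grad p /\<^sub>R gradient_length p) (Grad p /\<^sub>R gradient_length p) = 0"
proof -
  have "differential Atl gradient_length p = (\<lambda>u. 0)"
    by (rule differential_unique[of "\<lambda>q. 1", OF _ V(1,2)]) (use V(3) in \<open>simp_all add: o_def\<close>)
  then show ?thesis using hessian_gradient[OF D p] by simp
qed

end

end


section \<open>Injectivity of the Legendre transformation of a Finsler metric\<close>

context conic_metric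
begin

lemma legendre_inner_strict_increasing:
  assumes c: "c \<in> Atl" and "v \<noteq> w"
    and segment: "\<And>t. 0 \<le> t \<Longrightarrow> t \<le> 1 \<Longrightarrow> (x, v + t *\<^sub>R (w - v)) \<in> slit_domain c"
  shows "legendre c (x, v) \<bullet> (w - v) < legendre c (x, w) \<bullet> (w - v)"
proof -
  let ?d = "w - v"
  let ?\<phi> = "\<lambda>t. legendre c (x, v + t *\<^sub>R ?d) \<bullet> ?d"
  have "?\<phi> 0 < ?\<phi> 1"
  proof (rule DERIV_pos_imp_increasing[OF zero_less_one])
    fix t :: real assume t: "0 \<le> t" "t \<le> 1"
    note z = segment[OF t]
    have "((\<lambda>s. ?\<phi> (s + t)) has_real_derivative legendre' c (x, v + t *\<^sub>R ?d) (0, ?d) \<bullet> ?d) (at 0)"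
      using legendre_inner_along_fiber[OF c z, of ?d ?d] by (simp add: scaleR_add_left add_ac)
    then have "(?\<phi> has_real_derivative legendre' c (x, v + t *\<^sub>R ?d) (0, ?d) \<bullet> ?d) (at t)"
      using DERIV_shift[of ?\<phi> _ 0 t] by simp
    moreover have "legendre' c (x, v + t *\<^sub>R ?d) (0, ?d) \<bullet> ?d > 0"
      using legendre'_pos[OF c z] assms(2) by simp
    ultimately show "\<exists>y. (?\<phi> has_real_derivative y) (at t) \<and> 0 < y" by blast
  qed
  then show ?thesis by simp
qed

end

text \<open>
  The energy is strictly convex along segments that avoid the origin, which decides the matter
  unless two vectors point in opposite directions; these are told apart by Euler's relation.
\<close>

lemma finsler_metric_imp_legendre_metric:
  assumes "smooth_atlas Atl" "finsler_metric Atl F"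
  shows "legendre_metric Atl UNIV F"
proof -
  interpret smooth_manifold Atl using assms(1) by unfold_locales
  interpret conic_metric Atl UNIV F
    using assms(2) unfolding finsler_metric_def by unfold_locales
  show ?thesis
  proof unfold_locales
    fix p and v w :: "real^'b"
    assume v: "v \<noteq> 0" and w: "w \<noteq> 0" and eq: "\<And>u. fund_tensor F p v v u = fund_tensor F p w w u"
    let ?c = "chart_at Atl p"
    let ?L = "\<lambda>v. legendre ?c (snd ?c p, v)"
    have L: "fund_tensor F p y y u = ?L y \<bullet> u" if "y \<noteq> 0" for y u
      using fund_tensor_radial(1)[OF chart_at UNIV_I that, of p u] by simp
    show "v = w"
    proof (rule ccontr)
      assume "v \<noteq> w"
      show False
      proof (cases "\<exists>t. 0 \<le> t \<and> t \<le> 1 \<and> v + t *\<^sub>R (w - v) = 0")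
        case False
        then have "(snd ?c p, v + t *\<^sub>R (w - v)) \<in> slit_domain ?c" if "0 \<le> t" "t \<le> 1" for t
          using that by simp
        from legendre_inner_strict_increasing[OF chart_at(1) \<open>v \<noteq> w\<close> this]
        have "?L v \<bullet> (w - v) < ?L w \<bullet> (w - v)" .
        then show False using eq[of "w - v"] L[OF v] L[OF w] by simp
      next
        case True
        \<comment> \<open>The common Legendre transform is positive on both vectors, but a nontrivial convex combination of them is zero.\<close>
        then obtain t where t: "0 \<le> t" "t \<le> 1" "v + t *\<^sub>R (w - v) = 0" by blast
        have pos: "?L v \<bullet> v > 0" "?L v \<bullet> w > 0"
          using fund_tensor_self[OF UNIV_I v] fund_tensor_self[OF UNIV_I w] metric_pos[OF UNIV_I v, of p]
            metric_pos[OF UNIV_I w, of p] eq[of w] L[OF v] L[OF w]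
          by (metis zero_less_power)+
        have "v + t *\<^sub>R (w - v) = (1 - t) *\<^sub>R v + t *\<^sub>R w" by (simp add: algebra_simps)
        then have "(1 - t) * (?L v \<bullet> v) + t * (?L v \<bullet> w) = 0"
          using t(3) by (metis inner_add_right inner_scaleR_right inner_zero_right)
        moreover have "(1 - t) * (?L v \<bullet> v) \<ge> 0" "t * (?L v \<bullet> w) \<ge> 0"
          using t pos by simp_all
        ultimately have "(1 - t) * (?L v \<bullet> v) = 0" "t * (?L v \<bullet> w) = 0" by linarith+
        then show False using pos by simp
      qed
    qed
  qed
qed


section \<open>Conic Zermelo metrics\<close>

context conic_metric
begin

lemma metric_along_fiber:
  assumes v: "(p, v) \<in> A" "v \<noteq> 0"
  shows "((\<lambda>t. F p (v + t *\<^sub>R w)) has_real_derivative fund_tensor F p v v w / F p v) (at 0)"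
proof -
  let ?c = "chart_at Atl p"
  let ?e = "\<lambda>t. 2 * energy ?c (snd ?c p, v + t *\<^sub>R w)"
  have dom: "(snd ?c p, v) \<in> slit_domain ?c" using v by simp
  have e: "?e t = (F p (v + t *\<^sub>R w))\<^sup>2" for t
    using energy_chart[OF chart_at, of p "v + t *\<^sub>R w"] by simp
  have "(?e has_real_derivative 2 * fund_tensor F p v v w) (at 0)"
    using DERIV_cmult[OF energy_along_fiber[OF chart_at(1) dom, of w], of 2]
      fund_tensor_radial(1)[OF chart_at v, of w] by simp
  moreover have e0: "?e 0 = (F p v)\<^sup>2" using e[of 0] by simp
  moreover have "(F p v)\<^sup>2 > 0" using metric_pos[OF v] by simp
  ultimately have "((\<lambda>t. sqrt (?e t)) has_real_derivative
      inverse (sqrt (?e 0)) / 2 * (2 * fund_tensor F p v v w)) (at 0)"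
    by (intro DERIV_chain2[OF DERIV_real_sqrt]) simp_all
  then have "((\<lambda>t. sqrt (?e t)) has_real_derivative fund_tensor F p v v w / F p v) (at 0)"
    unfolding e0 using metric_pos[OF v] by (simp add: field_simps)
  moreover have "\<forall>\<^sub>F t in nhds 0. F p (v + t *\<^sub>R w) = sqrt (?e t)"
    using eventually_slit_domain[OF chart_at(1) dom, of w]
    by (rule eventually_mono) (use e conic_metric_axioms(4) in simp)
  ultimately show ?thesis by (rule DERIV_transfer_ev)
qed

end

locale zermelo_metric = smooth_manifold Atl
  for Atl :: "('m::{t2_space, second_countable_topology}, 'n::finite) chart set" +
  fixes F :: "'m \<Rightarrow> real^'n \<Rightarrow> real" and W :: "'m \<Rightarrow> real^'n"
    and A :: "('m \<times> (real^'n)) set" and Z :: "'m \<Rightarrow> real^'n \<Rightarrow> real"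
  assumes zermelo: "conic_zermelo_metric Atl F W A Z"
begin

lemma zermelo_axioms:
  shows "finsler_metric Atl F" "smooth_vf_on Atl UNIV W" "conic_finsler_metric Atl A Z"
    and "\<forall>p v r. (p, v) \<in> A \<longrightarrow> r > 0 \<longrightarrow> (Z p v = r \<longleftrightarrow> (p, v /\<^sub>R r) \<in> zermelo_indicatrix F W)"
proof -
  note z = zermelo[unfolded conic_zermelo_metric_def]
  show "finsler_metric Atl F" using z by (elim conjE)
  show "smooth_vf_on Atl UNIV W" using z by (elim conjE)
  show "conic_finsler_metric Atl A Z" using z by (elim conjE)
  show "\<forall>p v r. (p, v) \<in> A \<longrightarrow> r > 0 \<longrightarrow> (Z p v = r \<longleftrightarrow> (p, v /\<^sub>R r) \<in> zermelo_indicatrix F W)"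
    using z by (elim conjE)
qed

sublocale F: legendre_metric Atl UNIV F
  by (rule finsler_metric_imp_legendre_metric[OF atlas zermelo_axioms(1)])

sublocale Z: conic_metric Atl A Z
  by unfold_locales (rule zermelo_axioms(3))

text \<open>The vector of the indicatrix of \<open>F\<close> whose translate by the wind is proportional to \<open>v\<close>.\<close>

definition unwind :: "'m \<Rightarrow> real^'n \<Rightarrow> real^'n" where "unwind p v = v /\<^sub>R Z p v - W p"

lemma F_0: "F p 0 = 0"
  using F.metric_scale[of p 0 2] by simp

lemma unwind:
  assumes v: "(p, v) \<in> A" "v \<noteq> 0"
  shows "F p (unwind p v) = 1" "unwind p v \<noteq> 0"
    and "1 + fund_tensor F p (unwind p v) (unwind p v) (W p) > 0"
proof -
  have "(p, v /\<^sub>R Z p v) \<in> zermelo_indicatrix F W"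
    using zermelo_axioms(4) v(1) Z.metric_pos[OF v] by blast
  then obtain u where "v /\<^sub>R Z p v = u + W p" "F p u = 1" "fund_tensor F p u u (- W p) < 1"
    unfolding zermelo_indicatrix_def by blast
  then have u: "F p (unwind p v) = 1" "fund_tensor F p (unwind p v) (unwind p v) (- W p) < 1"
    by (simp_all add: unwind_def)
  show "F p (unwind p v) = 1" by fact
  then show "unwind p v \<noteq> 0" using F_0 by force
  from linear_neg[OF F.linear_fund_tensor_radial[OF UNIV_I this]] u(2)
  show "1 + fund_tensor F p (unwind p v) (unwind p v) (W p) > 0" by simp
qed

text \<open>
  Differentiating \<open>F(v / Z(v) - W) = 1\<close> in \<open>v\<close>: the indicatrices of \<open>F\<close> and \<open>Z\<close> have the same
  conormal directions at corresponding points, which is why both metrics see the same level sets.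
\<close>

lemma fund_tensor_unwind:
  assumes v: "(p, v) \<in> A" "v \<noteq> 0"
  defines "u \<equiv> unwind p v"
  shows "fund_tensor Z p v v w * (1 + fund_tensor F p u u (W p)) = Z p v * fund_tensor F p u u w"
proof -
  let ?c = "chart_at Atl p"
  let ?x = "snd ?c p"
  define \<mu> where "\<mu> = Z p v"
  define b where "b = fund_tensor Z p v v w / \<mu>"
  define l where "l = F.legendre ?c (?x, u)"
  have \<mu>: "\<mu> > 0" using Z.metric_pos[OF v] by (simp add: \<mu>_def)
  have u: "F p u = 1" "u \<noteq> 0" unfolding u_def by (rule unwind[OF v])+
  have dom: "(?x, u) \<in> F.slit_domain ?c" using u by simp
  have l: "fund_tensor F p u u y = l \<bullet> y" for y
    using F.fund_tensor_radial(1)[OF chart_at UNIV_I u(2), of p y] by (simp add: l_def)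
  let ?\<gamma> = "\<lambda>t. inverse (Z p (v + t *\<^sub>R w)) *\<^sub>R (v + t *\<^sub>R w) - W p"
  \<comment> \<open>The velocity at \<open>0\<close> of the curve \<open>v / Z(v) - W\<close> when \<open>v\<close> moves with velocity \<open>w\<close>.\<close>
  define g where "g = inverse \<mu> *\<^sub>R w - (inverse \<mu> * b * inverse \<mu>) *\<^sub>R v"
  have "((\<lambda>t. Z p (v + t *\<^sub>R w)) has_derivative (\<lambda>s. s * b)) (at 0)"
    using Z.metric_along_fiber[OF v, of w, folded \<mu>_def, folded b_def]
    by (simp add: has_field_derivative_def mult_commute_abs)
  from Deriv.has_derivative_inverse[OF _ this] \<mu>
  have inv: "((\<lambda>t. inverse (Z p (v + t *\<^sub>R w))) has_derivative (\<lambda>s. - (inverse \<mu> * (s * b) * inverse \<mu>))) (at 0)"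
    by (simp add: \<mu>_def)
  have line: "((\<lambda>t. v + t *\<^sub>R w) has_derivative (\<lambda>s. s *\<^sub>R w)) (at 0)"
    by (auto intro!: derivative_eq_intros)
  have \<gamma>: "(?\<gamma> has_derivative (\<lambda>s. s *\<^sub>R g)) (at 0)"
    by (rule has_derivative_eq_rhs[OF has_derivative_diff[OF has_derivative_scaleR[OF inv line] has_derivative_const]])
       (simp add: fun_eq_iff g_def \<mu>_def[symmetric] algebra_simps)
  have "?\<gamma> 0 = u" by (simp add: u_def unwind_def)
  then have "(F.energy ?c has_derivative frechet_derivative (F.energy ?c) (at (?x, u))) (at (?x, ?\<gamma> 0))"
    using F.energy_has_derivative[OF chart_at(1) dom] by simp
  from has_derivative_compose[OF has_derivative_Pair[OF has_derivative_const \<gamma>] this]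
  have "((\<lambda>t. F.energy ?c (?x, ?\<gamma> t)) has_derivative (\<lambda>s. l \<bullet> (s *\<^sub>R g))) (at 0)"
    by (simp add: l_def F.legendre_inner[OF chart_at(1) dom] del: inner_scaleR_right)
  then have "((\<lambda>t. F.energy ?c (?x, ?\<gamma> t)) has_real_derivative l \<bullet> g) (at 0)"
    by (simp add: has_field_derivative_def mult_commute_abs)
  moreover have "\<forall>\<^sub>F t in nhds 0. 1 / 2 = F.energy ?c (?x, ?\<gamma> t)"
  proof -
    have "(?x, v) \<in> Z.slit_domain ?c" using v by simp
    from Z.eventually_slit_domain[OF chart_at(1) this, of w] show ?thesis
    proof (rule eventually_mono)
      fix t assume "(?x, v + t *\<^sub>R w) \<in> Z.slit_domain ?c"
      then have "F p (?\<gamma> t) = 1" using unwind(1)[of p "v + t *\<^sub>R w"] by (simp add: unwind_def)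
      with F.energy_chart[OF chart_at, of p "?\<gamma> t"] show "1 / 2 = F.energy ?c (?x, ?\<gamma> t)" by simp
    qed
  qed
  ultimately have "((\<lambda>t. 1 / 2 :: real) has_real_derivative l \<bullet> g) (at 0)"
    by (rule DERIV_transfer_ev)
  then have "l \<bullet> g = 0" using DERIV_const DERIV_unique by blast
  then have "l \<bullet> w = b * (l \<bullet> (inverse \<mu> *\<^sub>R v))"
    using \<mu> by (simp add: g_def inner_diff_right field_simps)
  also have "inverse \<mu> *\<^sub>R v = u + W p" by (simp add: u_def unwind_def \<mu>_def)
  also have "l \<bullet> (u + W p) = 1 + l \<bullet> W p"
    using F.fund_tensor_self[OF UNIV_I u(2)] l[of u] u(1) by (simp add: inner_add_right)
  finally show ?thesis using \<mu> by (simp add: l b_def \<mu>_def[symmetric] field_simps)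
qed

text \<open>
  The Legendre transforms of \<open>v\<close> for \<open>Z\<close> and of its unwound vector for \<open>F\<close> are positive multiples of
  each other, and this scale is the factor that makes them equal. If \<open>v\<close> is a gradient for \<open>Z\<close>, the
  scaled unwound vector is therefore the gradient of the same function for \<open>F\<close>.
\<close>

definition unwind_scale :: "'m \<Rightarrow> real^'n \<Rightarrow> real" where
  "unwind_scale p v = Z p v / (1 + fund_tensor F p (unwind p v) (unwind p v) (W p))"

lemma legendre_unwind:
  assumes v: "(p, v) \<in> A" "v \<noteq> 0"
  defines "u \<equiv> unwind_scale p v *\<^sub>R unwind p v"
  shows "fund_tensor F p u u w = fund_tensor Z p v v w" "u \<noteq> 0"
    and "F p u = unwind_scale p v" "unwind_scale p v > 0"
proof -
  show pos: "unwind_scale p v > 0"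
    unfolding unwind_scale_def using unwind(3)[OF v] Z.metric_pos[OF v] by simp
  show "u \<noteq> 0" using pos unwind(2)[OF v] by (simp add: u_def)
  show "F p u = unwind_scale p v"
    unfolding u_def using F.metric_scale[OF UNIV_I pos] unwind(1)[OF v] by simp
  show "fund_tensor F p u u w = fund_tensor Z p v v w"
    unfolding u_def F.fund_tensor_scale_base[OF UNIV_I unwind(2)[OF v] pos]
    using fund_tensor_unwind[OF v, of w] unwind(3)[OF v] by (simp add: unwind_scale_def field_simps)
qed

text \<open>
  The injectivity for \<open>F\<close> recovers the unwound vector, hence the direction of \<open>v\<close>; the length of \<open>v\<close>
  is the value of its Legendre transform on the unit vector in that direction.
\<close>

lemma Z_legendre_inj:
  assumes v: "(p, v) \<in> A" "v \<noteq> 0" and w: "(p, w) \<in> A" "w \<noteq> 0"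
    and eq: "\<And>u. fund_tensor Z p v v u = fund_tensor Z p w w u"
  shows "v = w"
proof -
  have same: "unwind_scale p v *\<^sub>R unwind p v = unwind_scale p w *\<^sub>R unwind p w"
    by (rule F.legendre_inj[where p = p, OF UNIV_I legendre_unwind(2)[OF v] UNIV_I legendre_unwind(2)[OF w]])
       (simp only: legendre_unwind(1)[OF v] legendre_unwind(1)[OF w] eq)
  then have "unwind_scale p v = unwind_scale p w"
    using legendre_unwind(3)[OF v] legendre_unwind(3)[OF w] by simp
  with same legendre_unwind(4)[OF w] have "unwind p v = unwind p w" by simp
  then have n: "v /\<^sub>R Z p v = w /\<^sub>R Z p w" by (simp add: unwind_def)
  have *: "fund_tensor Z p y y (y /\<^sub>R Z p y) = Z p y" if y: "(p, y) \<in> A" "y \<noteq> 0" for y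
    using Z.fund_tensor_self[OF y] Z.metric_pos[OF y]
    by (simp add: linear_scale[OF Z.linear_fund_tensor_radial[OF y]] power2_eq_square)
  have "Z p v = Z p w" using *[OF v] *[OF w] n eq by simp
  with n Z.metric_pos[OF w] show ?thesis by simp
qed

sublocale Z: legendre_metric Atl A Z
  by unfold_locales (rule Z_legendre_inj)

text \<open>
  The wind is the difference of the two normalized gradients: the indicatrix of \<open>Z\<close> is that of \<open>F\<close>
  translated by \<open>W\<close>, and corresponding points have parallel conormals.
\<close>

lemma gradient_unwind:
  assumes f: "smooth_fun_on Atl U f" and p: "p \<in> regular_admissible Atl A Z U f"
  defines "v \<equiv> gradient Atl A Z f p" and "u \<equiv> gradient Atl UNIV F f p"
  shows "p \<in> regular_admissible Atl UNIV F U f" "v /\<^sub>R Z p v = u /\<^sub>R F p u + W p"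
proof -
  have G: "is_gradient Atl A Z f p v" unfolding v_def by (rule Z.is_gradient_gradient[OF p])
  then have v: "(p, v) \<in> A" "v \<noteq> 0" "\<And>w. fund_tensor Z p v v w = differential Atl f p w"
    unfolding is_gradient_def by blast+
  let ?s = "unwind_scale p v"
  have GF: "is_gradient Atl UNIV F f p (?s *\<^sub>R unwind p v)"
    unfolding is_gradient_def using legendre_unwind(1,2)[OF v(1,2)] v(3) by simp
  then have u: "u = ?s *\<^sub>R unwind p v" unfolding u_def by (rule F.gradient_eq)
  have "p \<in> U" using p unfolding regular_admissible_def by blast
  with GF show "p \<in> regular_admissible Atl UNIV F U f"
    using F.regular_admissible_iff[OF f] by blast
  show "v /\<^sub>R Z p v = u /\<^sub>R F p u + W p"
    unfolding u legendre_unwind(3)[OF v(1,2)] using legendre_unwind(4)[OF v(1,2)]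
    by (simp add: unwind_def)
qed

lemma divergence_normalized_gradients:
  assumes \<nu>: "volume_form Atl \<nu>" and U: "open U" and f: "smooth_fun_on Atl U f"
    and p: "p \<in> regular_admissible Atl A Z U f"
  defines "gZ \<equiv> gradient Atl A Z f" and "gF \<equiv> gradient Atl UNIV F f"
  shows "divergence Atl \<nu> (\<lambda>q. gZ q /\<^sub>R Z q (gZ q)) p =
    divergence Atl \<nu> (\<lambda>q. gF q /\<^sub>R F q (gF q)) p + divergence Atl \<nu> W p"
proof -
  let ?c = "chart_at Atl p"
  have nF: "vf_rep Atl ?c (\<lambda>q. gF q /\<^sub>R F q (gF q)) differentiable (at (snd ?c p))"
    using F.normalized_gradient_differentiable[OF U f gradient_unwind(1)[OF f p]]
    unfolding gF_def F.gradient_length_def[OF U f] .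
  have W: "vf_rep Atl ?c W differentiable (at (snd ?c p))"
    by (rule smooth_vf_differentiable[OF zermelo_axioms(2) chart_at(1) UNIV_I chart_at(2)])
  have "vf_rep Atl ?c (\<lambda>q. gF q /\<^sub>R F q (gF q) + W q) differentiable (at (snd ?c p))"
    by (rule differentiable_vf_rep[OF chart_at _ differentiable_add[OF nF W]])
       (simp add: vf_rep_chart chart_at linear_add[OF linear_dchart])
  then have "divergence Atl \<nu> (\<lambda>q. gZ q /\<^sub>R Z q (gZ q)) p =
      divergence Atl \<nu> (\<lambda>q. gF q /\<^sub>R F q (gF q) + W q) p"
    by (rule divergence_cong[OF \<nu> Z.open_regular[OF U f] p, rotated])
       (simp only: gZ_def gF_def gradient_unwind(2)[OF f])
  also have "\<dots> = divergence Atl \<nu> (\<lambda>q. gF q /\<^sub>R F q (gF q)) p + divergence Atl \<nu> W p"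
    by (rule divergence_add[OF \<nu> nF W])
  finally show ?thesis .
qed

text \<open>
  Applying \<open>df\<close> to the relation between the normalized gradients: it takes each of them to the length of
  the corresponding gradient, and it kills a tangent wind.
\<close>

lemma F_gradient_unit:
  assumes f: "smooth_fun_on Atl U f" and p: "p \<in> regular_admissible Atl A Z U f"
    and unit: "Z p (gradient Atl A Z f p) = 1" and tangent: "differential Atl f p (W p) = 0"
  shows "F p (gradient Atl UNIV F f p) = 1"
proof -
  let ?v = "gradient Atl A Z f p" and ?u = "gradient Atl UNIV F f p"
  note GZ = Z.is_gradient_gradient[OF p] and GF = F.is_gradient_gradient[OF gradient_unwind(1)[OF f p]]
  have lin: "linear (differential Atl f p)"
    by (rule linear_differential) (use p in \<open>simp add: regular_admissible_def\<close>)
  have "?v = ?u /\<^sub>R F p ?u + W p" using gradient_unwind(2)[OF f p] unit by simp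
  then have "differential Atl f p ?v = differential Atl f p (?u /\<^sub>R F p ?u + W p)" by (rule arg_cong)
  also have "\<dots> = F p ?u"
    using tangent F.is_gradient_differential[OF GF]
    by (simp add: linear_add[OF lin] linear_scale[OF lin] power2_eq_square)
  finally show ?thesis using Z.is_gradient_differential(1)[OF GZ] unit by simp
qed

end

lemma (in smooth_manifold) tangent_to_fibers_differential:
  assumes t: "tangent_to_fibers Atl U f W" and p: "p \<in> U" "differentiable_at Atl f p"
  shows "differential Atl f p (W p) = 0"
proof (cases "differential Atl f p = (\<lambda>u. 0)")
  case False
  let ?c = "chart_at Atl p"
  from t p(1) False obtain \<gamma> where \<gamma>: "\<gamma> 0 = p"
    and ev: "\<forall>\<^sub>F t in nhds 0. \<gamma> t \<in> U \<inter> fst ?c \<and> f (\<gamma> t) = f p"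
    and vel: "((snd ?c \<circ> \<gamma>) has_vector_derivative W p) (at 0)"
    unfolding tangent_to_fibers_def by blast
  have "(f \<circ> cinv ?c has_derivative differential Atl f p) (at ((snd ?c \<circ> \<gamma>) 0))"
    using differential_has_derivative[OF p(2)] \<gamma> by simp
  from has_derivative_compose[OF vel[unfolded has_vector_derivative_def] this]
  have "((\<lambda>t. (f \<circ> cinv ?c) ((snd ?c \<circ> \<gamma>) t)) has_real_derivative differential Atl f p (W p)) (at 0)"
    by (simp add: has_field_derivative_def linear_scale[OF linear_differential[OF p(2)]] mult_commute_abs)
  moreover have "\<forall>\<^sub>F t in nhds 0. f p = (f \<circ> cinv ?c) ((snd ?c \<circ> \<gamma>) t)"
    using ev by (rule eventually_mono) (simp add: chart_at)
  ultimately have "((\<lambda>t. f p) has_real_derivative differential Atl f p (W p)) (at 0)"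
    by (rule DERIV_transfer_ev)
  then show ?thesis using DERIV_const DERIV_unique by blast
qed simp

theorem proposition1p2:
  fixes Atl :: "('m::{t2_space, second_countable_topology}, 'n::finite) chart set"
    and F Z :: "'m \<Rightarrow> real^'n \<Rightarrow> real"
    and W :: "'m \<Rightarrow> real^'n"
    and A :: "('m \<times> (real^'n)) set"
    and \<nu> :: "('m, 'n) chart \<Rightarrow> 'm \<Rightarrow> real"
    and DF DZ :: "'m set \<Rightarrow> ('m \<Rightarrow> real^'n) \<Rightarrow> ('m, 'n) connection"
    and U :: "'m set"
    and f :: "'m \<Rightarrow> real"
  defines "gF \<equiv> gradient Atl UNIV F f"
    and "gZ \<equiv> gradient Atl A Z f"
    and "HF \<equiv> hessian Atl UNIV F DF U f"
    and "HZ \<equiv> hessian Atl A Z DZ U f"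
    and "LF \<equiv> laplacian Atl UNIV F \<nu> f"
    and "LZ \<equiv> laplacian Atl A Z \<nu> f"
    and "R \<equiv> regular_admissible Atl A Z U f"
  assumes "smooth_atlas Atl"
    and "connected (UNIV :: 'm set)"
    and "conic_zermelo_metric Atl F W A Z"
    and "volume_form Atl \<nu>"
    and "chern_connection Atl UNIV F DF"
    and "chern_connection Atl A Z DZ"
    and "open U"
    and "smooth_fun_on Atl U f"
  shows "(\<forall>p\<in>R.
            1 / Z p (gZ p) * (LZ p - HZ p (gZ p /\<^sub>R Z p (gZ p)) (gZ p /\<^sub>R Z p (gZ p))) =
            1 / F p (gF p) * (LF p - HF p (gF p /\<^sub>R F p (gF p)) (gF p /\<^sub>R F p (gF p)))
            + divergence Atl \<nu> W p) \<and>
         (distance_function Atl A Z U f \<longrightarrow>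
            (\<forall>p\<in>R. LZ p =
               1 / F p (gF p) * (LF p - HF p (gF p /\<^sub>R F p (gF p)) (gF p /\<^sub>R F p (gF p)))
               + divergence Atl \<nu> W p)) \<and>
         (distance_function Atl A Z U f \<and> tangent_to_fibers Atl U f W \<longrightarrow>
            (\<forall>p\<in>R. LZ p = LF p + divergence Atl \<nu> W p))"
proof -
  note \<nu> = \<open>volume_form Atl \<nu>\<close> and DF = \<open>chern_connection Atl UNIV F DF\<close>
    and DZ = \<open>chern_connection Atl A Z DZ\<close> and U = \<open>open U\<close> and f = \<open>smooth_fun_on Atl U f\<close>
  interpret zermelo_metric Atl F W A Z
    using \<open>smooth_atlas Atl\<close> \<open>conic_zermelo_metric Atl F W A Z\<close> by unfold_locales
  have RF: "p \<in> regular_admissible Atl UNIV F U f" if "p \<in> R" for p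
    using gradient_unwind(1)[OF f] that unfolding R_def .
  have main: "1 / Z p (gZ p) * (LZ p - HZ p (gZ p /\<^sub>R Z p (gZ p)) (gZ p /\<^sub>R Z p (gZ p))) =
            1 / F p (gF p) * (LF p - HF p (gF p /\<^sub>R F p (gF p)) (gF p /\<^sub>R F p (gF p)))
            + divergence Atl \<nu> W p" if p: "p \<in> R" for p
    using Z.divergence_normalized_gradient[OF U f DZ \<nu> p[unfolded R_def]]
      F.divergence_normalized_gradient[OF U f DF \<nu> RF[OF p]]
      divergence_normalized_gradients[OF \<nu> U f p[unfolded R_def]]
    unfolding Z.gradient_length_def[OF U f] F.gradient_length_def[OF U f] gF_def gZ_def HF_def HZ_def LF_def LZ_def
    by linarith
  have open_R: "open R" unfolding R_def by (rule Z.open_regular[OF U f])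
  have dist: "LZ p = 1 / F p (gF p) * (LF p - HF p (gF p /\<^sub>R F p (gF p)) (gF p /\<^sub>R F p (gF p)))
            + divergence Atl \<nu> W p"
    if d: "distance_function Atl A Z U f" and p: "p \<in> R" for p
  proof -
    have unit: "Z q (gZ q) = 1" if "q \<in> R" for q
      using d that unfolding distance_function_def R_def gZ_def by blast
    have "HZ p (gZ p /\<^sub>R Z p (gZ p)) (gZ p /\<^sub>R Z p (gZ p)) = 0"
      using Z.hessian_unit_length[OF U f DZ p[unfolded R_def] open_R p] unit
      unfolding Z.gradient_length_def[OF U f] gZ_def HZ_def by blast
    with main[OF p] unit[OF p] show ?thesis by simp
  qed
  have tangent: "LZ p = LF p + divergence Atl \<nu> W p"
    if d: "distance_function Atl A Z U f" and t: "tangent_to_fibers Atl U f W" and p: "p \<in> R" for p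
  proof -
    have unit: "F q (gF q) = 1" if "q \<in> R" for q
    proof -
      have "Z q (gZ q) = 1" using d that unfolding distance_function_def R_def gZ_def by blast
      moreover have "differential Atl f q (W q) = 0"
        by (rule tangent_to_fibers_differential[OF t])
           (use that in \<open>simp_all add: R_def regular_admissible_def\<close>)
      ultimately show ?thesis
        using F_gradient_unit[OF f] that unfolding R_def gZ_def gF_def by blast
    qed
    have "HF p (gF p /\<^sub>R F p (gF p)) (gF p /\<^sub>R F p (gF p)) = 0"
      using F.hessian_unit_length[OF U f DF RF[OF p] open_R p] unit
      unfolding F.gradient_length_def[OF U f] gF_def HF_def by blast
    with dist[OF d p] unit[OF p] show ?thesis by simp
  qed
  from main dist tangent show ?thesis by blast
qed

end
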